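(* Let $H_1,H_2$ be Hilbert spaces with $\dim H_2<\infty$, and let $\mathfrak{B}=\{X\in\mathcal{B}(H_2,H_1):\|X\|<1\}$. If a group of biholomorphic transformations of $\mathfrak{B}$ has an orbit contained in the ball $r\overline{\mathfrak{B}}=\{X\in\mathcal{B}(H_2,H_1):\|X\|\le r\}$, where $r<1$, then the group has a (common) fixed point $K\in r\overline{\mathfrak{B}}$.
   Context: $\mathcal{B}(H_2,H_1)$ is the Banach space of all bounded linear operators from $H_2$ to $H_1$ with the operator norm. The Hilbert spaces are complex. A biholomorphic transformation of $\mathfrak{B}$ is a holomorphic bijection of $\mathfrak{B}$ onto itself with holomorphic inverse; the group operation is composition. A fixed point of a group $\Gamma$ of transformations is a point $K$ with $\phi(K)=K$ for all $\phi\in\Gamma$; an orbit is a set $\{\phi(X):\phi\in\Gamma\}$ with $X\in\mathfrak{B}$. *)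

theory Defs
  imports "HOL-Analysis.Analysis" "HOL-Algebra.Bij"
begin

section \<open>Complex Hilbert spaces\<close>

class scaleC =
  fixes scaleC :: "complex \<Rightarrow> 'a \<Rightarrow> 'a" (infixr "*\<^sub>C" 75)

class complex_vector = real_vector + scaleC +
  assumes scaleC_add_right: "a *\<^sub>C (x + y) = a *\<^sub>C x + a *\<^sub>C y"
    and scaleC_add_left: "(a + b) *\<^sub>C x = a *\<^sub>C x + b *\<^sub>C x"
    and scaleC_scaleC: "a *\<^sub>C b *\<^sub>C x = (a * b) *\<^sub>C x"
    and scaleC_one: "1 *\<^sub>C x = x"
    and scaleR_scaleC: "r *\<^sub>R x = complex_of_real r *\<^sub>C x"

class complex_normed_vector = complex_vector + real_normed_vector +
  assumes norm_scaleC: "norm (a *\<^sub>C x) = cmod a * norm x"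

text \<open>The inner product is linear in the second argument; this choice is immaterial below,
  where only the induced norm matters.\<close>

class complex_inner = complex_normed_vector +
  fixes cinner :: "'a \<Rightarrow> 'a \<Rightarrow> complex"
  assumes cinner_commute: "cinner x y = cnj (cinner y x)"
    and cinner_add_right: "cinner x (y + z) = cinner x y + cinner x z"
    and cinner_scaleC_right: "cinner x (a *\<^sub>C y) = a * cinner x y"
    and cinner_ge_zero: "0 \<le> Re (cinner x x)"
    and cinner_eq_zero_iff: "cinner x x = 0 \<longleftrightarrow> x = 0"
    and norm_eq_sqrt_cinner: "norm x = sqrt (Re (cinner x x))"

class chilbert_space = complex_inner + complete_space


section \<open>The space of bounded complex-linear operators\<close>

definition bounded_clinear :: "('a::complex_normed_vector \<Rightarrow> 'b::complex_normed_vector) \<Rightarrow> bool"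
  where "bounded_clinear f \<longleftrightarrow> bounded_linear f \<and> (\<forall>c x. f (c *\<^sub>C x) = c *\<^sub>C f x)"

typedef (overloaded) ('a, 'b) cblinfun =
  "{f :: 'a::complex_normed_vector \<Rightarrow> 'b::complex_normed_vector. bounded_clinear f}"
  morphisms cblinfun_apply CBlinfun
proof
  show "(\<lambda>_. 0) \<in> {f :: 'a \<Rightarrow> 'b. bounded_clinear f}"
    using scaleC_add_right[of _ "0::'b" 0] by (simp add: bounded_clinear_def)
qed

setup_lifting type_definition_cblinfun

lemma scaleC_zero_right [simp]: "c *\<^sub>C (0::'a::complex_vector) = 0"
  using scaleC_add_right[of c "0::'a" 0] by simp

lemma scaleC_minus_right [simp]: "c *\<^sub>C (- x) = - (c *\<^sub>C (x::'a::complex_vector))"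
  using scaleC_add_right[of c x "- x"] by (simp add: eq_neg_iff_add_eq_0 add.commute)

lemma scaleC_diff_right: "c *\<^sub>C (x - y) = c *\<^sub>C x - c *\<^sub>C (y::'a::complex_vector)"
  using scaleC_add_right[of c x "- y"] by simp

lemma bounded_clinear_scaleC:
  assumes "bounded_clinear f"
  shows "bounded_clinear (\<lambda>x. c *\<^sub>C f x)"
proof -
  have "bounded_linear (\<lambda>x::'b. c *\<^sub>C x)"
    by (rule bounded_linear_intro[where K = "cmod c"])
      (simp_all add: scaleC_add_right scaleR_scaleC scaleC_scaleC norm_scaleC mult.commute)
  from bounded_linear_compose[OF this] assms show ?thesis
    by (auto simp: bounded_clinear_def scaleC_scaleC mult.commute)
qed

instantiation cblinfun :: (complex_normed_vector, complex_normed_vector) complex_normed_vector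
begin

lift_definition norm_cblinfun :: "('a, 'b) cblinfun \<Rightarrow> real" is onorm .

lift_definition zero_cblinfun :: "('a, 'b) cblinfun" is "\<lambda>x. 0"
  by (simp add: bounded_clinear_def)

lift_definition plus_cblinfun :: "('a, 'b) cblinfun \<Rightarrow> ('a, 'b) cblinfun \<Rightarrow> ('a, 'b) cblinfun"
  is "\<lambda>f g x. f x + g x"
  by (simp add: bounded_clinear_def bounded_linear_add scaleC_add_right)

lift_definition minus_cblinfun :: "('a, 'b) cblinfun \<Rightarrow> ('a, 'b) cblinfun \<Rightarrow> ('a, 'b) cblinfun"
  is "\<lambda>f g x. f x - g x"
  by (simp add: bounded_clinear_def bounded_linear_sub scaleC_diff_right)

lift_definition uminus_cblinfun :: "('a, 'b) cblinfun \<Rightarrow> ('a, 'b) cblinfun" is "\<lambda>f x. - f x"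
  by (simp add: bounded_clinear_def bounded_linear_minus)

lift_definition scaleC_cblinfun :: "complex \<Rightarrow> ('a, 'b) cblinfun \<Rightarrow> ('a, 'b) cblinfun"
  is "\<lambda>c f x. c *\<^sub>C f x"
  by (rule bounded_clinear_scaleC)

definition scaleR_cblinfun :: "real \<Rightarrow> ('a, 'b) cblinfun \<Rightarrow> ('a, 'b) cblinfun"
  where "scaleR_cblinfun r f = complex_of_real r *\<^sub>C f"

definition dist_cblinfun :: "('a, 'b) cblinfun \<Rightarrow> ('a, 'b) cblinfun \<Rightarrow> real"
  where "dist_cblinfun f g = norm (f - g)"

definition sgn_cblinfun :: "('a, 'b) cblinfun \<Rightarrow> ('a, 'b) cblinfun"
  where "sgn_cblinfun f = inverse (norm f) *\<^sub>R f"

definition uniformity_cblinfun :: "(('a, 'b) cblinfun \<times> ('a, 'b) cblinfun) filter"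
  where "uniformity_cblinfun = (INF e\<in>{0 <..}. principal {(x, y). dist x y < e})"

definition open_cblinfun :: "('a, 'b) cblinfun set \<Rightarrow> bool"
  where "open_cblinfun S = (\<forall>x\<in>S. \<forall>\<^sub>F (x', y) in uniformity. x' = x \<longrightarrow> y \<in> S)"

instance
proof
  fix f g h :: "('a, 'b) cblinfun" and r s :: real
    and S :: "('a, 'b) cblinfun set"
  show "f + g + h = f + (g + h)" "f + g = g + f" "0 + f = f" "- f + f = 0" "f - g = f + - g"
    by (transfer, force)+
  show C: "a *\<^sub>C (f + g) = a *\<^sub>C f + a *\<^sub>C g" "(a + b) *\<^sub>C f = a *\<^sub>C f + b *\<^sub>C f"
    "a *\<^sub>C b *\<^sub>C f = (a * b) *\<^sub>C f" "1 *\<^sub>C f = f" for a b and f g :: "('a, 'b) cblinfun"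
    by (transfer, simp add: scaleC_add_right scaleC_add_left scaleC_scaleC scaleC_one)+
  show "r *\<^sub>R f = complex_of_real r *\<^sub>C f"
    by (rule scaleR_cblinfun_def)
  show "r *\<^sub>R (f + g) = r *\<^sub>R f + r *\<^sub>R g" "(r + s) *\<^sub>R f = r *\<^sub>R f + s *\<^sub>R f"
    "r *\<^sub>R s *\<^sub>R f = (r * s) *\<^sub>R f" "1 *\<^sub>R f = f"
    by (simp_all add: scaleR_cblinfun_def C)
  show "norm (f + g) \<le> norm f + norm g"
    by transfer (auto simp: bounded_clinear_def intro: onorm_triangle)
  show "(norm f = 0) = (f = 0)"
    by transfer (auto simp: bounded_clinear_def onorm_eq_0)
  show "dist f g = norm (f - g)" by (rule dist_cblinfun_def)
  show "sgn f = inverse (norm f) *\<^sub>R f" by (rule sgn_cblinfun_def)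
  show "(uniformity :: (('a, 'b) cblinfun \<times> ('a, 'b) cblinfun) filter)
      = (INF e\<in>{0 <..}. principal {(x, y). dist x y < e})"
    by (rule uniformity_cblinfun_def)
  show "open S = (\<forall>x\<in>S. \<forall>\<^sub>F (x', y) in uniformity. x' = x \<longrightarrow> y \<in> S)"
    by (rule open_cblinfun_def)
  show N: "norm (a *\<^sub>C f) = cmod a * norm f" for a and f :: "('a, 'b) cblinfun"
  proof (transfer fixing: a)
    fix f :: "'a \<Rightarrow> 'b"
    assume "bounded_clinear f"
    then have "bounded_linear f" by (simp add: bounded_clinear_def)
    from onorm_scaleR[OF this, of "cmod a"]
    show "onorm (\<lambda>x. a *\<^sub>C f x) = cmod a * onorm f"
      by (simp add: onorm_def norm_scaleC)
  qed
  show "norm (r *\<^sub>R f) = \<bar>r\<bar> * norm f"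
    by (simp add: scaleR_cblinfun_def N)
qed

end


section \<open>Biholomorphic transformations\<close>

text \<open>Holomorphy on an open subset of a complex normed space: at every point there is a
  Frechet derivative that is complex-linear. As the derivative is taken at the point and not
  within \<open>S\<close>, the values of \<open>f\<close> off the open set \<open>S\<close> are irrelevant.\<close>

definition frechet_holomorphic_on ::
    "('a::complex_normed_vector \<Rightarrow> 'b::complex_normed_vector) \<Rightarrow> 'a set \<Rightarrow> bool"
  where "frechet_holomorphic_on f S \<longleftrightarrow>
    open S \<and> (\<forall>x\<in>S. \<exists>D. bounded_clinear D \<and> (f has_derivative D) (at x))"

text \<open>Elements of \<open>Bij S\<close> are extensional (\<open>undefined\<close> off \<open>S\<close>), so that transformations of \<open>S\<close>
  are equal iff they agree on \<open>S\<close>. They form the group \<open>BijGroup S\<close> under composition.\<close>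

definition Biholomorphic :: "'a::complex_normed_vector set \<Rightarrow> ('a \<Rightarrow> 'a) set"
  where "Biholomorphic S =
    {f \<in> Bij S. frechet_holomorphic_on f S \<and> frechet_holomorphic_on (inv_into S f) S}"

end

theory Submission
  imports Defs "HOL-Complex_Analysis.Conformal_Mappings"
begin

text \<open>For points \<open>Z\<close>, \<open>X\<close> of the ball put \<open>[w, u] = \<langle>w, u\<rangle> - \<langle>Z w, X u\<rangle>\<close>. The Kobayashi
  distance of \<open>Z\<close> and \<open>X\<close> is at most \<open>artanh s\<close> iff
  \<open>(1 - s\<^sup>2) |[w, u]|\<^sup>2 \<le> (|w|\<^sup>2 - |Z w|\<^sup>2) (|u|\<^sup>2 - |X u|\<^sup>2)\<close> for all \<open>w\<close> and \<open>u\<close>: necessity is the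
  Schwarz lemma, for sufficiency there is an explicit holomorphic disc. Hence this relation, which
  is closed and convex in \<open>X\<close>, is preserved by biholomorphic maps, and so is the intersection of
  all Kobayashi balls containing the orbit, a closed convex subset of the ball of radius \<open>r\<close>.

  Among the nonempty closed convex invariant subsets \<open>M\<close> of that ball choose one for which the
  space \<open>agree M\<close> of all \<open>u\<close> with \<open>X u\<close> independent of \<open>X \<in> M\<close> has maximal dimension. The set of
  Chebyshev centers of \<open>M\<close> is again such a set (it is nonempty since nested closed convex sets of
  operators meet), but if \<open>M\<close> has two points, then its \<open>agree\<close> space is strictly larger: the
  mean \<open>z\<close> of finitely many centers cannot do better than they do, so equality in the convexity
  estimate, attained in the limit, yields a unit vector \<open>l\<close> on which all centers agree, while
  \<open>Y l = z l\<close> for all \<open>Y \<in> M\<close> would make the distances between \<open>z\<close> and \<open>M\<close> vanish. So \<open>M\<close> is a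
  single point.\<close>

section \<open>Complex inner products\<close>

lemma scaleC_zero_left [simp]: "0 *\<^sub>C (x::'a::complex_vector) = 0"
  using scaleR_scaleC[of 0 x] by simp

lemma scaleC_minus_left [simp]: "(- a) *\<^sub>C (x::'a::complex_vector) = - (a *\<^sub>C x)"
  using scaleC_add_left[of a "- a" x] by (simp add: eq_neg_iff_add_eq_0 add.commute)

lemma scaleC_diff_left: "(a - b) *\<^sub>C (x::'a::complex_vector) = a *\<^sub>C x - b *\<^sub>C x"
  using scaleC_add_left[of a "- b" x] by simp

lemma scaleC_sum_right: "c *\<^sub>C (\<Sum>i\<in>I. f i) = (\<Sum>i\<in>I. c *\<^sub>C (f i :: 'a::complex_vector))"
  by (induction I rule: infinite_finite_induct) (simp_all add: scaleC_add_right)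

lemma bounded_bilinear_scaleC:
  "bounded_bilinear (scaleC :: complex \<Rightarrow> 'a::complex_normed_vector \<Rightarrow> 'a)"
proof
  show "\<exists>K. \<forall>a (b::'a). norm (a *\<^sub>C b) \<le> norm a * norm b * K"
    by (rule exI[of _ 1]) (simp add: norm_scaleC)
qed (simp_all add: scaleC_add_left scaleC_add_right scaleR_scaleC scaleC_scaleC scaleR_conv_of_real
      mult.commute)

lemmas tendsto_scaleC = bounded_bilinear.tendsto[OF bounded_bilinear_scaleC]

text \<open>Evaluating the form on \<open>y + c x\<close> with \<open>c = - t B x y\<close> gives a
  real quadratic in \<open>t\<close> that is never negative. The form may be degenerate, so the
  lemma covers both \<open>cinner\<close> and the positive semidefinite form
  \<open>iform Z Z\<close>.\<close>

lemma hermitian_form_Cauchy_Schwarz: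
  fixes B :: "'a::complex_vector \<Rightarrow> 'a \<Rightarrow> complex"
  assumes add: "\<And>x y z. B x (y + z) = B x y + B x z"
    and scale: "\<And>x y c. B x (c *\<^sub>C y) = c * B x y"
    and herm: "\<And>x y. B y x = cnj (B x y)"
    and pos: "\<And>x. 0 \<le> Re (B x x)"
  shows "(cmod (B x y))\<^sup>2 \<le> Re (B x x) * Re (B y y)"
proof -
  define m where "m = (cmod (B x y))\<^sup>2"
  have addl: "B (u + v) z = B u z + B v z" for u v z
    using herm[of "u + v" z] herm[of u z] herm[of v z] by (simp add: add)
  have scalel: "B (c *\<^sub>C u) z = cnj c * B u z" for c u z
    using herm[of "c *\<^sub>C u" z] herm[of u z] by (simp add: scale)
  have key: "0 \<le> Re (B y y) - 2 * t * m + t\<^sup>2 * m * Re (B x x)" for t :: real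
  proof -
    define c where "c = - of_real t * B x y"
    have "B y x = cnj (B x y)" by (rule herm)
    then have 1: "c * B y x = - of_real (t * m)" "cnj c * B x y = - of_real (t * m)"
      unfolding c_def m_def of_real_mult complex_norm_square by (simp_all add: mult_ac)
    have 2: "cnj c * c = of_real (t\<^sup>2 * m)"
      unfolding c_def m_def of_real_mult complex_norm_square by (simp add: power2_eq_square mult_ac)
    have "B (y + c *\<^sub>C x) (y + c *\<^sub>C x) = B y y + c * B y x + cnj c * B x y + cnj c * c * B x x"
      by (simp add: add addl scale scalel algebra_simps)
    also have "Re \<dots> = Re (B y y) - 2 * t * m + t\<^sup>2 * m * Re (B x x)"
      unfolding 1 2 by (simp add: algebra_simps)
    finally show ?thesis using pos[of "y + c *\<^sub>C x"] by simp
  qed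
  show ?thesis
  proof (cases "Re (B x x) = 0")
    case True
    have "m \<le> 0"
    proof (rule ccontr)
      assume "\<not> m \<le> 0"
      \<comment> \<open>For this \<open>t\<close> the expression \<open>Re (B y y) - 2 t m\<close>
        equals -1.\<close>
      then show False using key[of "(Re (B y y) + 1) / (2 * m)"] True by simp
    qed
    with True show ?thesis by (simp add: m_def)
  next
    case False
    with pos[of x] have a: "0 < Re (B x x)" by simp
    \<comment> \<open>The minimizer of the quadratic in \<open>t\<close>.\<close>
    from key[of "1 / Re (B x x)"] a have "0 \<le> Re (B y y) - m / Re (B x x)"
      by (simp add: power2_eq_square)
    with a have "m \<le> Re (B y y) * Re (B x x)" by (simp add: field_simps)
    then show ?thesis by (simp add: m_def mult.commute)
  qed
qed

lemma cinner_add_left: "cinner (x + y) z = cinner x z + cinner y (z::'a::complex_inner)"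
  using cinner_commute[of "x + y" z] cinner_commute[of x z] cinner_commute[of y z]
  by (simp add: cinner_add_right)

lemma cinner_scaleC_left: "cinner (a *\<^sub>C x) y = cnj a * cinner x (y::'a::complex_inner)"
  using cinner_commute[of "a *\<^sub>C x" y] cinner_commute[of x y] by (simp add: cinner_scaleC_right)

lemma cinner_zero_right [simp]: "cinner x (0::'a::complex_inner) = 0"
  using cinner_add_right[of x 0 0] by simp

lemma cinner_zero_left [simp]: "cinner (0::'a::complex_inner) x = 0"
  using cinner_add_left[of 0 0 x] by simp

lemma cinner_minus_right [simp]: "cinner x (- y) = - cinner x (y::'a::complex_inner)"
  using cinner_add_right[of x y "- y"] by (simp add: eq_neg_iff_add_eq_0 add.commute)

lemma cinner_minus_left [simp]: "cinner (- x) y = - cinner x (y::'a::complex_inner)"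
  using cinner_add_left[of x "- x" y] by (simp add: eq_neg_iff_add_eq_0 add.commute)

lemma cinner_diff_right: "cinner x (y - z) = cinner x y - cinner x (z::'a::complex_inner)"
  using cinner_add_right[of x y "- z"] by simp

lemma cinner_sum_right: "cinner x (\<Sum>i\<in>I. f i) = (\<Sum>i\<in>I. cinner x (f i :: 'a::complex_inner))"
  by (induction I rule: infinite_finite_induct) (simp_all add: cinner_add_right)

lemma Re_cinner_self: "Re (cinner x x) = (norm (x::'a::complex_inner))\<^sup>2"
  by (simp add: norm_eq_sqrt_cinner cinner_ge_zero)

lemma cinner_self: "cinner x x = of_real ((norm (x::'a::complex_inner))\<^sup>2)"
proof -
  have "Im (cinner x x) = 0" using cinner_commute[of x x] by (metis complex_cnj_cancel_iff
    complex_eq_iff cnj.simps(2) equal_neg_zero)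
  then show ?thesis by (simp add: complex_eq_iff Re_cinner_self)
qed

lemma cmod_cinner_le: "cmod (cinner x y) \<le> norm x * norm (y::'a::complex_inner)"
proof -
  have "(cmod (cinner x y))\<^sup>2 \<le> Re (cinner x x) * Re (cinner y y)"
    by (rule hermitian_form_Cauchy_Schwarz)
      (simp_all add: cinner_add_right cinner_scaleC_right cinner_ge_zero cinner_commute[symmetric])
  then have "(cmod (cinner x y))\<^sup>2 \<le> (norm x * norm y)\<^sup>2"
    by (simp add: Re_cinner_self power_mult_distrib)
  then show ?thesis by (rule power2_le_imp_le) simp
qed

lemma norm_add_sq:
  "(norm (x + y))\<^sup>2 = (norm x)\<^sup>2 + 2 * Re (cinner x y) + (norm (y::'a::complex_inner))\<^sup>2"
  using cinner_commute[of y x]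
  by (simp add: Re_cinner_self[symmetric] cinner_add_left cinner_add_right)

lemma norm_diff_sq:
  "(norm (x - y))\<^sup>2 = (norm x)\<^sup>2 - 2 * Re (cinner x y) + (norm (y::'a::complex_inner))\<^sup>2"
  using norm_add_sq[of x "- y"] by simp

lemma bounded_bilinear_cinner: "bounded_bilinear (cinner :: 'a::complex_inner \<Rightarrow> 'a \<Rightarrow> complex)"
proof
  show "\<exists>K. \<forall>a (b::'a). norm (cinner a b) \<le> norm a * norm b * K"
    by (rule exI[of _ 1]) (simp add: cmod_cinner_le)
qed (simp_all add: cinner_add_left cinner_add_right scaleR_scaleC cinner_scaleC_left
      cinner_scaleC_right scaleR_conv_of_real)

lemmas tendsto_cinner = bounded_bilinear.tendsto[OF bounded_bilinear_cinner]

section \<open>Bounded operators\<close>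

lemma bounded_clinear_cblinfun_apply: "bounded_clinear (cblinfun_apply X)"
  using cblinfun_apply by auto

lemma bounded_linear_cblinfun_apply: "bounded_linear (cblinfun_apply X)"
  using bounded_clinear_cblinfun_apply by (auto simp: bounded_clinear_def)

lemma cblinfun_apply_scaleC_right: "cblinfun_apply X (c *\<^sub>C u) = c *\<^sub>C cblinfun_apply X u"
  using bounded_clinear_cblinfun_apply by (auto simp: bounded_clinear_def)

lemma cblinfun_apply_CBlinfun: "bounded_clinear f \<Longrightarrow> cblinfun_apply (CBlinfun f) = f"
  by (simp add: CBlinfun_inverse)

lemma cblinfun_eqI: "(\<And>u. cblinfun_apply X u = cblinfun_apply Y u) \<Longrightarrow> X = Y"
  by (metis cblinfun_apply_inject ext)

lemma norm_cblinfun_apply_le: "norm (cblinfun_apply X u) \<le> norm X * norm u"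
  by transfer (auto simp: bounded_clinear_def intro: onorm)

lemma norm_cblinfun_le: "0 \<le> b \<Longrightarrow> (\<And>u. norm (cblinfun_apply X u) \<le> b * norm u) \<Longrightarrow> norm X \<le> b"
  by transfer (rule onorm_bound)

lemma cblinfun_apply_simps [simp]:
  "cblinfun_apply 0 u = 0"
  "cblinfun_apply (X + Y) u = cblinfun_apply X u + cblinfun_apply Y u"
  "cblinfun_apply (X - Y) u = cblinfun_apply X u - cblinfun_apply Y u"
  "cblinfun_apply (- X) u = - cblinfun_apply X u"
  "cblinfun_apply (c *\<^sub>C X) u = c *\<^sub>C cblinfun_apply X u"
  by (transfer, simp)+

lemma cblinfun_apply_scaleR [simp]: "cblinfun_apply (a *\<^sub>R X) u = a *\<^sub>R cblinfun_apply X u"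
  by (simp add: scaleR_scaleC)

lemmas cblinfun_apply_add_right = linear_add[OF bounded_linear.linear[OF bounded_linear_cblinfun_apply]]
lemmas cblinfun_apply_diff_right = linear_diff[OF bounded_linear.linear[OF bounded_linear_cblinfun_apply]]
lemmas cblinfun_apply_zero_right = linear_0[OF bounded_linear.linear[OF bounded_linear_cblinfun_apply]]
lemmas cblinfun_apply_sum_right = linear_sum[OF bounded_linear.linear[OF bounded_linear_cblinfun_apply]]
lemmas cblinfun_apply_right = cblinfun_apply_add_right cblinfun_apply_diff_right
  cblinfun_apply_zero_right cblinfun_apply_scaleC_right

lemma cblinfun_apply_sum_left: "cblinfun_apply (\<Sum>i\<in>I. X i) u = (\<Sum>i\<in>I. cblinfun_apply (X i) u)"
  by (induction I rule: infinite_finite_induct) simp_all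

lemma bounded_bilinear_cblinfun_apply: "bounded_bilinear cblinfun_apply"
proof
  show "\<exists>K. \<forall>X u. norm (cblinfun_apply X u) \<le> norm X * norm u * K"
    by (rule exI[of _ 1]) (simp add: norm_cblinfun_apply_le)
qed (simp_all add: cblinfun_apply_add_right scaleR_scaleC cblinfun_apply_scaleC_right)

lemmas tendsto_cblinfun_apply = bounded_bilinear.tendsto[OF bounded_bilinear_cblinfun_apply]

lift_definition cblinfun_compose ::
    "('b::complex_normed_vector, 'c::complex_normed_vector) cblinfun
      \<Rightarrow> ('a::complex_normed_vector, 'b) cblinfun \<Rightarrow> ('a, 'c) cblinfun" (infixl "\<circ>\<^sub>C" 75)
  is "\<lambda>f g x. f (g x)"
  by (auto simp: bounded_clinear_def intro: bounded_linear_compose)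

lift_definition cblinfun_id :: "('a::complex_normed_vector, 'a) cblinfun" is "\<lambda>x. x"
  by (simp add: bounded_clinear_def bounded_linear_ident)

lemma cblinfun_apply_compose [simp]:
  "cblinfun_apply (X \<circ>\<^sub>C Y) u = cblinfun_apply X (cblinfun_apply Y u)"
  by transfer simp

lemma cblinfun_apply_id [simp]: "cblinfun_apply cblinfun_id u = u"
  by transfer simp

lemma norm_cblinfun_compose_le: "norm (X \<circ>\<^sub>C Y) \<le> norm X * norm Y"
proof (rule norm_cblinfun_le)
  fix u
  have "norm (cblinfun_apply X (cblinfun_apply Y u)) \<le> norm X * norm (cblinfun_apply Y u)"
    by (rule norm_cblinfun_apply_le)
  also have "\<dots> \<le> norm X * (norm Y * norm u)"
    by (intro mult_left_mono norm_cblinfun_apply_le) simp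
  finally show "norm (cblinfun_apply (X \<circ>\<^sub>C Y) u) \<le> norm X * norm Y * norm u"
    by (simp add: mult.assoc)
qed simp

lemma bounded_bilinear_cblinfun_compose: "bounded_bilinear (\<circ>\<^sub>C)"
proof
  show "\<exists>K. \<forall>X Y. norm (X \<circ>\<^sub>C Y) \<le> norm X * norm Y * K"
    by (rule exI[of _ 1]) (simp add: norm_cblinfun_compose_le)
qed (auto intro!: cblinfun_eqI simp: cblinfun_apply_right scaleR_scaleC)

lemmas tendsto_cblinfun_compose = bounded_bilinear.tendsto[OF bounded_bilinear_cblinfun_compose]

section \<open>Operators on a finite-dimensional space\<close>

lemma cinner_sum_left: "cinner (\<Sum>i\<in>I. f i) y = (\<Sum>i\<in>I. cinner (f i :: 'a::complex_inner) y)"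
  by (induction I rule: infinite_finite_induct) (simp_all add: cinner_add_left)

definition orthonormal_basis :: "'a::complex_inner set \<Rightarrow> bool"
  where "orthonormal_basis E \<longleftrightarrow> finite E \<and>
    (\<forall>e\<in>E. \<forall>f\<in>E. cinner e f = (if e = f then 1 else 0)) \<and>
    (\<forall>u. u = (\<Sum>e\<in>E. cinner e u *\<^sub>C e))"

text \<open>Orthonormal sets are independent, so their cardinality is bounded and a largest one
  exists. If the expansion failed for some \<open>u\<close>, the normalized residual could be added
  to it.\<close>

lemma orthonormal_basis_exists:
  assumes "\<exists>Basis :: 'a::complex_inner set. finite_dimensional_vector_space scaleC Basis"
  obtains E :: "'a::complex_inner set" where "orthonormal_basis E"
proof -
  from assms obtain Basis :: "'a set" where "finite_dimensional_vector_space scaleC Basis" by blast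
  then interpret fd: finite_dimensional_vector_space scaleC Basis .
  define ON where "ON S \<longleftrightarrow> finite S \<and> (\<forall>e\<in>S. \<forall>f\<in>S. cinner e f = (if e = f then 1 else 0))"
    for S :: "'a set"
  have coef: "cinner e (\<Sum>f\<in>S. c f *\<^sub>C f) = c e" if "ON S" "e \<in> S" for S c e
  proof -
    have "cinner e (\<Sum>f\<in>S. c f *\<^sub>C f) = (\<Sum>f\<in>S. if f = e then c f else 0)"
      unfolding cinner_sum_right cinner_scaleC_right
      using that by (intro sum.cong) (auto simp: ON_def)
    then show ?thesis using that by (simp add: ON_def)
  qed
  have bound: "card S \<le> fd.dim UNIV" if "ON S" for S
  proof -
    have "fd.independent S"
    proof (rule fd.independent_if_scalars_zero)
      show "finite S" using that by (simp add: ON_def)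
      fix c e assume "(\<Sum>f\<in>S. c f *\<^sub>C f) = 0" "e \<in> S"
      with coef[OF that, of e c] show "c e = 0" by simp
    qed
    then show ?thesis by (intro fd.independent_card_le_dim) auto
  qed
  have "ON {}" by (simp add: ON_def)
  then obtain E where E: "ON E" and max: "\<And>S. ON S \<Longrightarrow> card S \<le> card E"
    using ex_has_greatest_nat[of ON "{}" card "Suc (fd.dim UNIV)"] bound by (meson le_imp_less_Suc)
  have "u = (\<Sum>e\<in>E. cinner e u *\<^sub>C e)" for u
  proof (rule ccontr)
    define v where "v = u - (\<Sum>e\<in>E. cinner e u *\<^sub>C e)"
    define g where "g = complex_of_real (inverse (norm v)) *\<^sub>C v"
    assume "\<not> ?thesis"
    then have v: "norm v \<noteq> 0" by (simp add: v_def)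
    then have "norm g = 1"
      by (simp add: g_def norm_scaleC norm_inverse)
    then have g1: "cinner g g = 1"
      by (simp add: cinner_self)
    have "cinner e v = 0" if "e \<in> E" for e
      using coef[OF E that, of "\<lambda>f. cinner f u"] by (simp add: v_def cinner_diff_right)
    then have eg: "cinner e g = 0" if "e \<in> E" for e
      using that by (simp add: g_def cinner_scaleC_right)
    then have ge: "cinner g e = 0" if "e \<in> E" for e
      using that cinner_commute[of g e] by simp
    have "g \<notin> E" using eg g1 by force
    moreover have "ON (insert g E)" using E eg ge g1 by (auto simp: ON_def)
    ultimately show False using max[of "insert g E"] E by (simp add: ON_def)
  qed
  then show ?thesis using that[of E] E by (simp add: ON_def orthonormal_basis_def)
qed

text \<open>The adjoint is written down in coordinates of an orthonormal basis of the domain. Its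
  norm bound comes from \<open>cinner (A h) (A h) = cinner (Z (A h)) h\<close>.\<close>

lemma adjoint_exists:
  fixes Z :: "('a::complex_inner, 'b::complex_inner) cblinfun"
  assumes "\<exists>Basis :: 'a set. finite_dimensional_vector_space scaleC Basis"
  obtains A :: "('b, 'a) cblinfun"
  where "\<And>w h. cinner w (cblinfun_apply A h) = cinner (cblinfun_apply Z w) h"
    and "norm A \<le> norm Z"
proof -
  obtain E :: "'a set" where E: "orthonormal_basis E"
    using orthonormal_basis_exists[OF assms] .
  define a where "a h = (\<Sum>e\<in>E. cinner (cblinfun_apply Z e) h *\<^sub>C e)" for h
  have inner: "cinner w (a h) = cinner (cblinfun_apply Z w) h" for w h
  proof -
    have "w = (\<Sum>e\<in>E. cinner e w *\<^sub>C e)" using E by (simp add: orthonormal_basis_def)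
    then have "cblinfun_apply Z w = (\<Sum>e\<in>E. cinner e w *\<^sub>C cblinfun_apply Z e)"
      by (metis (no_types, lifting) cblinfun_apply_sum_right cblinfun_apply_scaleC_right sum.cong)
    then have "cinner (cblinfun_apply Z w) h = (\<Sum>e\<in>E. cnj (cinner e w) * cinner (cblinfun_apply Z e) h)"
      by (simp add: cinner_sum_left cinner_scaleC_left)
    then show ?thesis
      by (simp add: a_def cinner_sum_right cinner_scaleC_right cinner_commute[symmetric] mult.commute)
  qed
  have le: "norm (a h) \<le> norm Z * norm h" for h
  proof -
    have "norm (a h) * norm (a h) = Re (cinner (cblinfun_apply Z (a h)) h)"
      by (simp add: inner[symmetric] Re_cinner_self power2_eq_square)
    also have "\<dots> \<le> norm (cblinfun_apply Z (a h)) * norm h"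
      using complex_Re_le_cmod cmod_cinner_le order_trans by blast
    also have "\<dots> \<le> (norm Z * norm (a h)) * norm h"
      by (intro mult_right_mono norm_cblinfun_apply_le) simp
    finally have "norm (a h) * norm (a h) \<le> (norm Z * norm h) * norm (a h)"
      by (simp add: mult_ac)
    then show ?thesis
      by (metis mult_le_cancel_right_pos norm_ge_zero mult_nonneg_nonneg order_le_less)
  qed
  have "bounded_linear a"
  proof (rule bounded_linear_intro)
    show "a (x + y) = a x + a y" for x y
      by (simp add: a_def cinner_add_right scaleC_add_left sum.distrib)
    show "a (t *\<^sub>R x) = t *\<^sub>R a x" for t x
      by (simp add: a_def scaleR_scaleC cinner_scaleC_right scaleC_sum_right scaleC_scaleC)
    show "norm (a x) \<le> norm x * norm Z" for x
      using le[of x] by (simp add: mult.commute)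
  qed
  then have "bounded_clinear a"
    by (simp add: bounded_clinear_def a_def cinner_scaleC_right scaleC_sum_right scaleC_scaleC)
  then have A: "cblinfun_apply (CBlinfun a) = a" by (rule cblinfun_apply_CBlinfun)
  show ?thesis
    by (rule that[of "CBlinfun a"]) (use inner le in \<open>auto simp: A intro: norm_cblinfun_le\<close>)
qed

text \<open>Total by convention: the value is meaningful only where the set-theoretic inverse is
  bounded and complex-linear, as in the next lemma.\<close>

definition cblinfun_inv ::
    "('a::complex_normed_vector, 'b::complex_normed_vector) cblinfun \<Rightarrow> ('b, 'a) cblinfun"
  where "cblinfun_inv A = CBlinfun (inv_into UNIV (cblinfun_apply A))"

text \<open>The lower bound gives injectivity, finite dimension then gives surjectivity, and
  \<open>1 / c\<close> bounds the inverse. This is how every operator inverse below is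
  obtained.\<close>

lemma bounded_below_inverse:
  fixes A :: "('a::complex_normed_vector, 'a) cblinfun"
  assumes fd: "\<exists>Basis :: 'a set. finite_dimensional_vector_space scaleC Basis"
    and c: "0 < c" and below: "\<And>u. c * norm u \<le> norm (cblinfun_apply A u)"
  shows "cblinfun_apply A (cblinfun_apply (cblinfun_inv A) u) = u"
    and "cblinfun_apply (cblinfun_inv A) (cblinfun_apply A u) = u"
proof -
  from fd obtain Basis :: "'a set" where "finite_dimensional_vector_space scaleC Basis" by blast
  then interpret fd: finite_dimensional_vector_space scaleC Basis .
  have lin: "Vector_Spaces.linear scaleC scaleC (cblinfun_apply A)"
    by unfold_locales (simp_all add: cblinfun_apply_right)
  have inj: "inj (cblinfun_apply A)"
  proof (rule injI)
    fix x y assume "cblinfun_apply A x = cblinfun_apply A y"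
    with below[of "x - y"] c show "x = y" by (simp add: cblinfun_apply_right mult_le_0_iff)
  qed
  have surj: "surj (cblinfun_apply A)"
    by (rule fd.linear_inj_imp_surj[OF lin inj])
  define R where "R = inv_into UNIV (cblinfun_apply A)"
  have AR: "cblinfun_apply A (R u) = u" for u
    unfolding R_def by (rule surj_f_inv_f[OF surj])
  have RA: "R (cblinfun_apply A u) = u" for u
    unfolding R_def by (rule inv_f_f[OF inj])
  have add: "R (x + y) = R x + R y" for x y
    using RA[of "R x + R y"] by (simp add: cblinfun_apply_right AR)
  have scale: "R (a *\<^sub>C x) = a *\<^sub>C R x" for a x
    using RA[of "a *\<^sub>C R x"] by (simp add: cblinfun_apply_right AR)
  have "bounded_linear R"
  proof (rule bounded_linear_intro[OF add])
    show "R (t *\<^sub>R x) = t *\<^sub>R R x" for t x by (simp add: scaleR_scaleC scale)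
    show "norm (R x) \<le> norm x * inverse c" for x
      using below[of "R x"] c by (simp add: AR field_simps)
  qed
  then have "bounded_clinear R" using scale by (simp add: bounded_clinear_def)
  then have "cblinfun_apply (cblinfun_inv A) = R"
    by (simp add: cblinfun_inv_def R_def cblinfun_apply_CBlinfun)
  then show "cblinfun_apply A (cblinfun_apply (cblinfun_inv A) u) = u"
    and "cblinfun_apply (cblinfun_inv A) (cblinfun_apply A u) = u"
    using AR RA by simp_all
qed

section \<open>Holomorphic curves\<close>

text \<open>Scaling by \<open>inverse (z - t)\<close> divides norms by \<open>cmod (z - t)\<close>,
  so both conditions say that the same real quotient tends to 0. Complex differentiability of curves
  can thus be checked on difference quotients.\<close>

lemma has_derivative_scaleC_iff:
  fixes f :: "complex \<Rightarrow> 'a::complex_normed_vector"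
  shows "(f has_derivative (\<lambda>s. s *\<^sub>C D)) (at t) \<longleftrightarrow>
    ((\<lambda>z. inverse (z - t) *\<^sub>C (f z - f t)) \<longlongrightarrow> D) (at t)"
proof -
  have bl: "bounded_linear (\<lambda>s. s *\<^sub>C D)"
    by (rule bounded_bilinear.bounded_linear_left[OF bounded_bilinear_scaleC])
  have eq: "norm ((f z - f t) - (z - t) *\<^sub>C D) / norm (z - t)
      = norm (inverse (z - t) *\<^sub>C (f z - f t) - D)" if "z \<noteq> t" for z
  proof -
    have "inverse (z - t) *\<^sub>C (f z - f t) - D
        = inverse (z - t) *\<^sub>C ((f z - f t) - (z - t) *\<^sub>C D)"
      using that by (simp add: scaleC_diff_right scaleC_scaleC scaleC_one)
    then show ?thesis by (simp only: norm_scaleC norm_inverse divide_inverse mult.commute)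
  qed
  have "(f has_derivative (\<lambda>s. s *\<^sub>C D)) (at t) \<longleftrightarrow>
    ((\<lambda>z. norm ((f z - f t) - (z - t) *\<^sub>C D) / norm (z - t)) \<longlongrightarrow> 0) (at t)"
    using bl by (simp add: has_derivative_iff_norm)
  also have "\<dots> \<longleftrightarrow> ((\<lambda>z. norm (inverse (z - t) *\<^sub>C (f z - f t) - D)) \<longlongrightarrow> 0) (at t)"
    by (rule tendsto_cong) (auto simp: eventually_at_filter eq)
  also have "\<dots> \<longleftrightarrow> ((\<lambda>z. inverse (z - t) *\<^sub>C (f z - f t)) \<longlongrightarrow> D) (at t)"
    by (simp only: tendsto_norm_zero_iff LIM_zero_iff)
  finally show ?thesis .
qed

notation cblinfun_apply (infixr "\<cdot>" 80)

section \<open>The invariant distance on the operator ball\<close>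

text \<open>The indefinite product of the graph vectors \<open>(w, Z w)\<close> and
  \<open>(u, X u)\<close> in the direct sum of the two Hilbert spaces.\<close>

definition iform ::
    "('a::complex_inner, 'b::complex_inner) cblinfun \<Rightarrow> ('a, 'b) cblinfun \<Rightarrow> 'a \<Rightarrow> 'a \<Rightarrow> complex"
  where "iform Z X w u = cinner w u - cinner (Z \<cdot> w) (X \<cdot> u)"

text \<open>For a contraction \<open>Z\<close> this is the squared norm of \<open>D u\<close>, where
  \<open>D\<close> is the defect operator, the square root of \<open>1 - A Z\<close> with
  \<open>A\<close> the adjoint of \<open>Z\<close>.\<close>

definition defect :: "('a::complex_inner, 'b::complex_inner) cblinfun \<Rightarrow> 'a \<Rightarrow> real"
  where "defect Z u = (norm u)\<^sup>2 - (norm (Z \<cdot> u))\<^sup>2"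

text \<open>For \<open>Z\<close> and \<open>X\<close> in the open unit ball and \<open>0 < k \<le> 1\<close> this says that their Kobayashi
  distance is at most \<open>artanh (sqrt (1 - k))\<close>.\<close>

definition near ::
    "real \<Rightarrow> ('a::complex_inner, 'b::complex_inner) cblinfun \<Rightarrow> ('a, 'b) cblinfun \<Rightarrow> bool"
  where "near k Z X \<longleftrightarrow> (\<forall>w u. k * (cmod (iform Z X w u))\<^sup>2 \<le> defect Z w * defect X u)"

lemma nearD: "near k Z X \<Longrightarrow> k * (cmod (iform Z X w u))\<^sup>2 \<le> defect Z w * defect X u"
  by (simp add: near_def)

lemma defect_ge: "(1 - (norm Z)\<^sup>2) * (norm u)\<^sup>2 \<le> defect Z u"
proof -
  have "(norm (Z \<cdot> u))\<^sup>2 \<le> (norm Z * norm u)\<^sup>2"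
    by (intro power_mono norm_cblinfun_apply_le) simp
  then show ?thesis by (simp add: defect_def power_mult_distrib algebra_simps)
qed

lemma defect_nonneg: "norm Z \<le> 1 \<Longrightarrow> 0 \<le> defect Z u"
  using defect_ge[of Z u] by (smt (verit) mult_nonneg_nonneg norm_ge_zero power_le_one zero_le_power2)

lemma iform_self: "iform Z Z u u = of_real (defect Z u)"
  by (simp add: iform_def defect_def cinner_self)

lemma iform_Cauchy_Schwarz:
  assumes "norm Z \<le> 1"
  shows "(cmod (iform Z Z w u))\<^sup>2 \<le> defect Z w * defect Z u"
proof -
  have "(cmod (iform Z Z w u))\<^sup>2 \<le> Re (iform Z Z w w) * Re (iform Z Z u u)"
  proof (rule hermitian_form_Cauchy_Schwarz)
    show "iform Z Z y x = cnj (iform Z Z x y)" for x y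
      by (simp add: iform_def cinner_commute[symmetric])
    show "0 \<le> Re (iform Z Z x x)" for x
      using defect_nonneg[OF assms] by (simp add: iform_self)
  qed (simp_all add: iform_def cblinfun_apply_right cinner_add_right cinner_scaleC_right algebra_simps)
  then show ?thesis by (simp add: iform_self)
qed

section \<open>Elementary properties of the relation \<open>near\<close>\<close>

lemma near_sym: "near k Z X \<Longrightarrow> near k X Z"
proof -
  have "iform X Z u w = cnj (iform Z X w u)" for w u
    by (simp add: iform_def cinner_commute[symmetric])
  then show "near k Z X \<Longrightarrow> near k X Z"
    by (simp add: near_def mult.commute[of "defect X _"])
qed

lemma near_mono: "near k Z X \<Longrightarrow> k' \<le> k \<Longrightarrow> near k' Z X"
  unfolding near_def by (meson mult_right_mono order_trans zero_le_power2)

text \<open>For fixed vectors the inequality is closed in the coefficient. This recovers boundary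
  values of \<open>k\<close>, in particular \<open>k = 1\<close>, which corresponds to the
  degenerate radius \<open>s = 0\<close> that the disc arguments exclude.\<close>

lemma near_limit:
  assumes "\<And>k'. k' < k \<Longrightarrow> near k' Z X"
  shows "near k Z X"
  unfolding near_def
proof (intro allI)
  fix w u
  let ?c = "(cmod (iform Z X w u))\<^sup>2" and ?d = "defect Z w * defect X u"
  have *: "k' * ?c \<le> ?d" if "k' < k" for k' using assms[OF that] by (rule nearD)
  show "k * ?c \<le> ?d"
  proof (cases "?c = 0")
    case True
    then show ?thesis using *[of "k - 1"] by simp
  next
    case False
    then have c: "0 < ?c" by simp
    have "k \<le> ?d / ?c"
      by (rule dense_le) (use * c in \<open>simp add: pos_le_divide_eq\<close>)
    with c show ?thesis by (simp add: pos_le_divide_eq)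
  qed
qed

lemma near_nonpos: "norm Z \<le> 1 \<Longrightarrow> norm X \<le> 1 \<Longrightarrow> k \<le> 0 \<Longrightarrow> near k Z X"
  unfolding near_def
  by (meson defect_nonneg mult_nonneg_nonneg mult_nonpos_nonneg order_trans zero_le_power2)

text \<open>Kobayashi balls about 0 are norm balls. One direction tests the relation with
  \<open>w = u\<close>, the other is Cauchy-Schwarz together with \<open>defect_ge\<close>.\<close>

lemma near_zero_iff:
  fixes X :: "('a::complex_inner, 'b::complex_inner) cblinfun"
  assumes "0 \<le> b" "b \<le> 1"
  shows "near (1 - b\<^sup>2) 0 X \<longleftrightarrow> norm X \<le> b"
proof
  assume n: "near (1 - b\<^sup>2) 0 X"
  show "norm X \<le> b"
  proof (rule norm_cblinfun_le[OF assms(1)])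
    fix u
    show "norm (X \<cdot> u) \<le> b * norm u"
    proof (cases "u = 0")
      case False
      have "(1 - b\<^sup>2) * ((norm u)\<^sup>2 * (norm u)\<^sup>2) \<le> (norm u)\<^sup>2 * ((norm u)\<^sup>2 - (norm (X \<cdot> u))\<^sup>2)"
        using nearD[OF n, of u u]
        by (simp add: iform_def defect_def cinner_self norm_mult power2_eq_square mult_ac)
      then have "(norm u)\<^sup>2 * ((1 - b\<^sup>2) * (norm u)\<^sup>2) \<le> (norm u)\<^sup>2 * ((norm u)\<^sup>2 - (norm (X \<cdot> u))\<^sup>2)"
        by (simp add: mult_ac)
      then have "(1 - b\<^sup>2) * (norm u)\<^sup>2 \<le> (norm u)\<^sup>2 - (norm (X \<cdot> u))\<^sup>2"
        using False by (subst (asm) mult_le_cancel_left_pos) simp_all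
      then have "(norm (X \<cdot> u))\<^sup>2 \<le> (b * norm u)\<^sup>2"
        by (simp add: power_mult_distrib algebra_simps)
      then show ?thesis by (rule power2_le_imp_le) (simp add: assms)
    qed (simp add: cblinfun_apply_right)
  qed
next
  assume X: "norm X \<le> b"
  have b: "0 \<le> 1 - b\<^sup>2" using assms by (simp add: power_le_one)
  show "near (1 - b\<^sup>2) 0 X"
    unfolding near_def
  proof (intro allI)
    fix w u :: 'a
    have "(cmod (cinner w u))\<^sup>2 \<le> (norm w * norm u)\<^sup>2"
      by (intro power_mono cmod_cinner_le) simp
    then have "(1 - b\<^sup>2) * (cmod (cinner w u))\<^sup>2 \<le> (1 - b\<^sup>2) * (norm w * norm u)\<^sup>2"
      using b by (rule mult_left_mono)
    also have "\<dots> = (norm w)\<^sup>2 * ((1 - b\<^sup>2) * (norm u)\<^sup>2)"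
      by (simp add: power_mult_distrib mult_ac)
    also have "\<dots> \<le> (norm w)\<^sup>2 * defect X u"
    proof (rule mult_left_mono)
      have "(norm X)\<^sup>2 \<le> b\<^sup>2" using X by (intro power_mono) simp_all
      then have "(1 - b\<^sup>2) * (norm u)\<^sup>2 \<le> (1 - (norm X)\<^sup>2) * (norm u)\<^sup>2"
        by (intro mult_right_mono) simp_all
      then show "(1 - b\<^sup>2) * (norm u)\<^sup>2 \<le> defect X u" using defect_ge[of X u] by linarith
    qed simp
    finally show "(1 - b\<^sup>2) * (cmod (iform 0 X w u))\<^sup>2 \<le> defect 0 w * defect X u"
      by (simp add: iform_def defect_def)
  qed
qed

text \<open>With \<open>w = u\<close> the product of the two defects is at most the square of their
  mean. Taking roots turns the inequality into a nonpositive bound for the squared norm of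
  \<open>Z u - X u\<close>.\<close>

lemma near_one_imp_eq:
  assumes "norm Z \<le> 1" "norm X \<le> 1" "near 1 Z X"
  shows "Z = X"
proof (rule cblinfun_eqI)
  fix u
  let ?a = "(norm u)\<^sup>2" and ?z = "(norm (Z \<cdot> u))\<^sup>2" and ?x = "(norm (X \<cdot> u))\<^sup>2"
  let ?c = "Re (cinner (Z \<cdot> u) (X \<cdot> u))"
  have n0: "0 \<le> ?a - ?z" "0 \<le> ?a - ?x"
    using defect_nonneg[OF assms(1), of u] defect_nonneg[OF assms(2), of u] by (simp_all add: defect_def)
  have "(?a - ?c)\<^sup>2 = (Re (iform Z X u u))\<^sup>2" by (simp add: iform_def cinner_self)
  also have "\<dots> \<le> (cmod (iform Z X u u))\<^sup>2"
    using abs_Re_le_cmod abs_le_square_iff by fastforce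
  also have "\<dots> \<le> (?a - ?z) * (?a - ?x)"
    using nearD[OF assms(3), of u u] by (simp add: defect_def)
  also have "\<dots> \<le> (?a - (?z + ?x) / 2)\<^sup>2"
  proof -
    have "(?a - (?z + ?x) / 2)\<^sup>2 - (?a - ?z) * (?a - ?x) = ((?z - ?x) / 2)\<^sup>2"
      by (simp add: power2_eq_square field_simps)
    then show ?thesis using zero_le_power2[of "(?z - ?x) / 2"] by linarith
  qed
  finally have "?a - ?c \<le> ?a - (?z + ?x) / 2"
    by (rule power2_le_imp_le) (use n0 in argo)
  then have "(norm (Z \<cdot> u - X \<cdot> u))\<^sup>2 \<le> 0"
    by (simp add: norm_diff_sq)
  then show "Z \<cdot> u = X \<cdot> u" by simp
qed

section \<open>Closedness and convexity of Kobayashi balls\<close>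

lemma closed_near: "closed {X. near k Z X}"
proof -
  have c: "continuous_on UNIV (\<lambda>X. X \<cdot> u)" for u :: 'a
    by (rule bounded_linear.continuous_on[OF bounded_bilinear.bounded_linear_left
          [OF bounded_bilinear_cblinfun_apply] continuous_on_id])
  have "continuous_on UNIV (\<lambda>X. iform Z X w u)" for w u
    unfolding iform_def
    by (intro continuous_intros bounded_bilinear.continuous_on[OF bounded_bilinear_cinner] c)
  then show ?thesis
    unfolding near_def defect_def
    by (intro closed_Collect_all closed_Collect_le continuous_intros c)
qed

lemma norm_sq_convex:
  fixes x y :: "'a::real_normed_vector"
  assumes "0 \<le> a" "0 \<le> b" "a + b = 1"
  shows "(norm (a *\<^sub>R x + b *\<^sub>R y))\<^sup>2 \<le> a * (norm x)\<^sup>2 + b * (norm y)\<^sup>2"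
proof -
  have "(norm (a *\<^sub>R x + b *\<^sub>R y))\<^sup>2 \<le> (a * norm x + b * norm y)\<^sup>2"
    using assms by (intro power_mono) (auto intro: norm_triangle_le)
  also have "\<dots> = a * (norm x)\<^sup>2 + b * (norm y)\<^sup>2 - a * b * (norm x - norm y)\<^sup>2"
  proof -
    have b: "b = 1 - a" using assms by simp
    show ?thesis unfolding b by (simp add: power2_eq_square algebra_simps)
  qed
  also have "\<dots> \<le> a * (norm x)\<^sup>2 + b * (norm y)\<^sup>2" using assms by simp
  finally show ?thesis .
qed

text \<open>In this form the right side is free of \<open>X\<close>, while for
  \<open>k \<ge> 0\<close> and a contraction \<open>Z\<close> the left side is a sum of convex
  functions of \<open>X\<close>.\<close>

lemma near_iff_quadratic:
  "near k Z X \<longleftrightarrow> (\<forall>w u. k * (cmod (iform Z X w u))\<^sup>2 + defect Z w * (norm (X \<cdot> u))\<^sup>2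
      \<le> defect Z w * (norm u)\<^sup>2)"
  unfolding near_def defect_def[of X] by (simp add: right_diff_distrib le_diff_eq)

lemma iform_affine:
  "a + b = 1 \<Longrightarrow> iform Z (a *\<^sub>R X + b *\<^sub>R Y) w u = a *\<^sub>R iform Z X w u + b *\<^sub>R iform Z Y w u"
proof -
  assume ab: "a + b = 1"
  have "a *\<^sub>R cinner w u + b *\<^sub>R cinner w u = cinner w u"
    using ab by (metis scaleR_add_left scaleR_one)
  then show ?thesis
    by (simp add: iform_def cinner_add_right scaleR_scaleC cinner_scaleC_right
        scaleR_conv_of_real algebra_simps)
qed

lemma convex_near:
  assumes "0 \<le> k" "norm Z \<le> 1"
  shows "convex {X. near k Z X}"
proof (rule convexI)
  fix X Y and a b :: real
  assume XY: "X \<in> {X. near k Z X}" "Y \<in> {X. near k Z X}" and ab: "0 \<le> a" "0 \<le> b" "a + b = 1"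
  show "a *\<^sub>R X + b *\<^sub>R Y \<in> {X. near k Z X}"
    unfolding near_iff_quadratic mem_Collect_eq
  proof (intro allI)
    fix w u
    let ?d = "defect Z w"
    let ?W = "a *\<^sub>R X + b *\<^sub>R Y"
    let ?g = "\<lambda>X. k * (cmod (iform Z X w u))\<^sup>2 + ?d * (norm (X \<cdot> u))\<^sup>2"
    have "(cmod (iform Z ?W w u))\<^sup>2 \<le> a * (cmod (iform Z X w u))\<^sup>2 + b * (cmod (iform Z Y w u))\<^sup>2"
      unfolding iform_affine[OF ab(3)] by (rule norm_sq_convex[OF ab])
    moreover have "(norm (?W \<cdot> u))\<^sup>2 \<le> a * (norm (X \<cdot> u))\<^sup>2 + b * (norm (Y \<cdot> u))\<^sup>2"
      using norm_sq_convex[OF ab] by simp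
    ultimately have "?g ?W \<le> k * (a * (cmod (iform Z X w u))\<^sup>2 + b * (cmod (iform Z Y w u))\<^sup>2)
        + ?d * (a * (norm (X \<cdot> u))\<^sup>2 + b * (norm (Y \<cdot> u))\<^sup>2)"
      by (intro add_mono mult_left_mono defect_nonneg assms)
    also have "\<dots> = a * ?g X + b * ?g Y" by (simp add: algebra_simps)
    also have "\<dots> \<le> a * (?d * (norm u)\<^sup>2) + b * (?d * (norm u)\<^sup>2)"
      using XY ab unfolding near_iff_quadratic by (intro add_mono mult_left_mono) auto
    also have "\<dots> = (a + b) * (?d * (norm u)\<^sup>2)" by (rule distrib_right[symmetric])
    finally show "?g ?W \<le> ?d * (norm u)\<^sup>2" by (simp only: ab mult_1)
  qed
qed

section \<open>A holomorphic disc through two points of the ball\<close>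

lemma norm_less_one:
  assumes c: "0 < c" and le: "\<And>u. (norm (X \<cdot> u))\<^sup>2 \<le> (1 - c) * (norm u)\<^sup>2"
  shows "norm X < 1"
proof -
  \<comment> \<open>The maximum keeps \<open>b\<close> nonnegative in case
    \<open>c > 1\<close>.\<close>
  define b where "b = sqrt (max 0 (1 - c))"
  have b: "0 \<le> b" "b < 1" "b\<^sup>2 = max 0 (1 - c)"
    using c by (simp_all add: b_def)
  have "norm X \<le> b"
  proof (rule norm_cblinfun_le[OF b(1)])
    fix u
    have "(norm (X \<cdot> u))\<^sup>2 \<le> (1 - c) * (norm u)\<^sup>2" by (rule le)
    also have "\<dots> \<le> b\<^sup>2 * (norm u)\<^sup>2" by (intro mult_right_mono) (simp_all add: b(3))
    also have "\<dots> = (b * norm u)\<^sup>2" by (simp add: power_mult_distrib)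
    finally show "norm (X \<cdot> u) \<le> b * norm u"
      by (rule power2_le_imp_le) (simp add: b)
  qed
  with b show ?thesis by linarith
qed

lemma id_minus_contraction_below:
  assumes "norm T \<le> c"
  shows "(1 - c) * norm u \<le> norm ((cblinfun_id - T) \<cdot> u)"
proof -
  have "norm (T \<cdot> u) \<le> c * norm u"
    using norm_cblinfun_apply_le[of T u] assms by (meson mult_right_mono norm_ge_zero order_trans)
  moreover have "norm u - norm (T \<cdot> u) \<le> norm (u - T \<cdot> u)" by (rule norm_triangle_ineq2)
  ultimately show ?thesis by (simp add: algebra_simps)
qed

text \<open>The vectors \<open>(v, Z v)\<close> and \<open>(A h, h)\<close> are orthogonal for the
  form \<open>|x|^2 - |y|^2\<close>, because \<open>A\<close> is adjoint to \<open>Z\<close>; hence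
  the mixed terms cancel.\<close>

lemma adjoint_defect_identity:
  assumes "\<And>w h. cinner w (A \<cdot> h) = cinner (Z \<cdot> w) h"
  shows "(norm (v + t *\<^sub>C A \<cdot> h))\<^sup>2 - (norm (Z \<cdot> v + t *\<^sub>C h))\<^sup>2
    = defect Z v - (cmod t)\<^sup>2 * ((norm h)\<^sup>2 - (norm (A \<cdot> h))\<^sup>2)"
  unfolding norm_add_sq
  by (simp add: assms cinner_scaleC_right norm_scaleC defect_def power_mult_distrib algebra_simps)

text \<open>The disc lives on \<open>cmod t < 1 / s\<close>, so after rescaling to the unit disc the
  point \<open>X\<close> is reached at parameter \<open>s\<close>. The relation \<open>near\<close>
  enters only through \<open>p_le\<close>, which controls the growth of the disc in
  \<open>t\<close>.\<close>

lemma near_imp_disc: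
  fixes Z X :: "('a::complex_inner, 'b::complex_inner) cblinfun"
  assumes fd: "\<exists>Basis :: 'a set. finite_dimensional_vector_space scaleC Basis"
    and Z: "norm Z < 1" and X: "norm X < 1" and near: "near (1 - s\<^sup>2) Z X"
    and s: "0 < s" "s < 1"
  shows "\<exists>\<psi>. \<psi> 0 = Z \<and> \<psi> 1 = X \<and>
    (\<forall>t. cmod t * s < 1 \<longrightarrow>
      norm (\<psi> t) < 1 \<and> (\<exists>D. (\<psi> has_derivative (\<lambda>z. z *\<^sub>C D)) (at t)))"
proof -
  obtain A :: "('b, 'a) cblinfun"
    where A: "\<And>w h. cinner w (A \<cdot> h) = cinner (Z \<cdot> w) h" and normA: "norm A \<le> norm Z"
    using adjoint_exists[OF fd, of Z] by blast
  have normAZ: "norm (A \<circ>\<^sub>C Z) \<le> (norm Z)\<^sup>2"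
    using norm_cblinfun_compose_le[of A Z] mult_right_mono[OF normA, of "norm Z"]
    by (simp add: power2_eq_square)
  have Z2: "(norm Z)\<^sup>2 < 1" and X2: "(norm X)\<^sup>2 < 1"
    using Z X by (simp_all add: abs_square_less_1)
  \<comment> \<open>The disc is \<open>\<psi> t = (Z V + t H) (V + t A H)\<^sup>-\<^sup>1\<close>. With \<open>V + A H = 1\<close> and \<open>Z V + H = X\<close> it passes
    through \<open>Z\<close> and \<open>X\<close>, and since \<open>A\<close> is the adjoint of \<open>Z\<close> there are no mixed terms in
    \<open>|V u + t A H u|\<^sup>2 - |Z V u + t H u|\<^sup>2\<close>.\<close>
  define Qi where "Qi = cblinfun_inv (cblinfun_id - A \<circ>\<^sub>C Z)"
  have Qi: "(cblinfun_id - A \<circ>\<^sub>C Z) \<cdot> Qi \<cdot> u = u" for u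
    unfolding Qi_def
    by (rule bounded_below_inverse(1)[OF fd _ id_minus_contraction_below[OF normAZ]])
      (simp add: Z2)
  \<comment> \<open>Eliminating \<open>H\<close> from \<open>V + A H = 1\<close> and
    \<open>Z V + H = X\<close> leaves \<open>(1 - A Z) V = 1 - A X\<close>.\<close>
  define V where "V = Qi \<circ>\<^sub>C (cblinfun_id - A \<circ>\<^sub>C X)"
  define H where "H = X - Z \<circ>\<^sub>C V"
  have QV: "V \<cdot> u - A \<cdot> Z \<cdot> V \<cdot> u = u - A \<cdot> X \<cdot> u" for u
    using Qi[of "u - A \<cdot> X \<cdot> u"] by (simp add: V_def)
  have VAH: "V \<cdot> u + A \<cdot> H \<cdot> u = u" for u
    using QV[of u] by (simp add: H_def cblinfun_apply_right algebra_simps)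
  have ZVH: "Z \<cdot> V \<cdot> u + H \<cdot> u = X \<cdot> u" for u
    by (simp add: H_def)
  define p where "p u = (norm (H \<cdot> u))\<^sup>2 - (norm (A \<cdot> H \<cdot> u))\<^sup>2" for u
  have p_nonneg: "0 \<le> p u" for u
  proof -
    have "norm (A \<cdot> h) \<le> norm h" for h
      using norm_cblinfun_apply_le[of A h] normA Z
      by (smt (verit) mult_left_le_one_le norm_ge_zero)
    then show ?thesis by (simp add: p_def)
  qed
  have defX: "defect X u = defect Z (V \<cdot> u) - p u" for u
    using adjoint_defect_identity[OF A, of "V \<cdot> u" 1 "H \<cdot> u"]
    by (simp add: scaleC_one VAH ZVH p_def defect_def)
  \<comment> \<open>The relation is tested at \<open>w = V u\<close>, where
    \<open>iform Z X w u\<close> collapses to \<open>defect Z (V u)\<close>.\<close>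
  have p_le: "p u \<le> s\<^sup>2 * defect Z (V \<cdot> u)" for u
  proof -
    let ?d = "defect Z (V \<cdot> u)"
    have "iform Z X (V \<cdot> u) u = cinner (V \<cdot> u) (u - A \<cdot> X \<cdot> u)"
      by (simp add: iform_def cinner_diff_right A)
    also have "\<dots> = of_real ?d"
      by (simp add: QV[symmetric] cinner_diff_right A cinner_self defect_def)
    finally have "(1 - s\<^sup>2) * (?d * ?d) \<le> ?d * defect X u"
      using nearD[OF near, of "V \<cdot> u" u] by (simp add: power2_eq_square)
    then have 1: "?d * ((1 - s\<^sup>2) * ?d) \<le> ?d * defect X u" by (simp add: mult_ac)
    have "(1 - s\<^sup>2) * ?d \<le> defect X u"
    proof (cases "?d = 0")
      case True
      then show ?thesis using defect_nonneg[of X u] X by simp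
    next
      case False
      then have "0 < ?d" using defect_nonneg[of Z "V \<cdot> u"] Z by simp
      with 1 show ?thesis by simp
    qed
    then show ?thesis using defX[of u] by (simp add: algebra_simps)
  qed
  define At where "At t = V + t *\<^sub>C (A \<circ>\<^sub>C H)" for t
  define Bt where "Bt t = Z \<circ>\<^sub>C V + t *\<^sub>C H" for t
  define \<delta> where "\<delta> t = (1 - (cmod t)\<^sup>2 * s\<^sup>2) * (1 - (norm X)\<^sup>2)" for t
  have \<delta>_pos: "0 < \<delta> t" if "cmod t * s < 1" for t
  proof -
    have "(cmod t * s)\<^sup>2 < 1" using that s by (simp add: abs_square_less_1)
    then show ?thesis using X2 by (simp add: \<delta>_def power_mult_distrib)
  qed
  \<comment> \<open>\<open>Bt t\<close> and \<open>At t\<close> are numerator and denominator of the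
    disc. This surplus makes the denominator bounded below, hence invertible, and the quotient a
    strict contraction.\<close>
  have gap: "\<delta> t * (norm u)\<^sup>2 \<le> (norm (At t \<cdot> u))\<^sup>2 - (norm (Bt t \<cdot> u))\<^sup>2"
    if t: "cmod t * s < 1" for t u
  proof -
    let ?d = "defect Z (V \<cdot> u)"
    have "(cmod t * s)\<^sup>2 < 1" using t s by (simp add: abs_square_less_1)
    then have t2: "0 \<le> 1 - (cmod t)\<^sup>2 * s\<^sup>2" by (simp add: power_mult_distrib)
    have "\<delta> t * (norm u)\<^sup>2 = (1 - (cmod t)\<^sup>2 * s\<^sup>2) * ((1 - (norm X)\<^sup>2) * (norm u)\<^sup>2)"
      by (simp add: \<delta>_def)
    also have "\<dots> \<le> (1 - (cmod t)\<^sup>2 * s\<^sup>2) * ?d"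
      using defect_ge[of X u] defX[of u] p_nonneg[of u] by (intro mult_left_mono t2) linarith
    also have "\<dots> = ?d - (cmod t)\<^sup>2 * (s\<^sup>2 * ?d)" by (simp add: algebra_simps)
    also have "\<dots> \<le> ?d - (cmod t)\<^sup>2 * p u"
      using mult_left_mono[OF p_le[of u], of "(cmod t)\<^sup>2"] by simp
    also have "\<dots> = (norm (At t \<cdot> u))\<^sup>2 - (norm (Bt t \<cdot> u))\<^sup>2"
      using adjoint_defect_identity[OF A, of "V \<cdot> u" t "H \<cdot> u"]
      by (simp add: At_def Bt_def p_def)
    finally show ?thesis .
  qed
  have below: "sqrt (\<delta> t) * norm u \<le> norm (At t \<cdot> u)" if t: "cmod t * s < 1" for t u
  proof (rule power2_le_imp_le)
    have "(sqrt (\<delta> t) * norm u)\<^sup>2 = \<delta> t * (norm u)\<^sup>2"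
      using \<delta>_pos[OF t] by (simp add: power_mult_distrib)
    also have "\<dots> \<le> (norm (At t \<cdot> u))\<^sup>2"
      using gap[OF t, of u] zero_le_power2[of "norm (Bt t \<cdot> u)"] by linarith
    finally show "(sqrt (\<delta> t) * norm u)\<^sup>2 \<le> (norm (At t \<cdot> u))\<^sup>2" .
  qed simp
  define R where "R t = cblinfun_inv (At t)" for t
  have AR: "At t \<cdot> R t \<cdot> u = u" and RA: "R t \<cdot> At t \<cdot> u = u" if t: "cmod t * s < 1" for t u
    unfolding R_def
    by (rule bounded_below_inverse[OF fd _ below[OF t]], simp add: \<delta>_pos[OF t])+
  define \<psi> where "\<psi> t = Bt t \<circ>\<^sub>C R t" for t
  have \<psi>A: "\<psi> t \<cdot> At t \<cdot> u = Bt t \<cdot> u" if "cmod t * s < 1" for t u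
    using RA[OF that] by (simp add: \<psi>_def)
  have "\<psi> 0 = Z"
  proof (rule cblinfun_eqI)
    fix u show "\<psi> 0 \<cdot> u = Z \<cdot> u"
      using AR[of 0 u] by (simp add: \<psi>_def Bt_def At_def)
  qed
  moreover have "\<psi> 1 = X"
  proof (rule cblinfun_eqI)
    fix u show "\<psi> 1 \<cdot> u = X \<cdot> u"
      using \<psi>A[of 1 u] s by (simp add: Bt_def At_def scaleC_one VAH ZVH)
  qed
  moreover have bound: "norm (\<psi> t) < 1" if t: "cmod t * s < 1" for t
  proof (rule norm_less_one)
    \<comment> \<open>The summand 1 keeps the divisor positive also when \<open>At t = 0\<close>, as
      on the zero space.\<close>
    define a where "a = norm (At t) + 1"
    have a: "0 < a" by (simp add: a_def add_nonneg_pos)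
    then show "0 < \<delta> t / a\<^sup>2" using \<delta>_pos[OF t] by simp
    fix v
    define u where "u = R t \<cdot> v"
    have v: "At t \<cdot> u = v" by (simp add: u_def AR[OF t])
    have "norm v \<le> norm (At t) * norm u" using norm_cblinfun_apply_le[of "At t" u] v by simp
    also have "\<dots> \<le> a * norm u" by (intro mult_right_mono) (simp_all add: a_def)
    finally have "(norm v)\<^sup>2 \<le> (a * norm u)\<^sup>2" by (intro power_mono) simp_all
    then have "(norm v)\<^sup>2 / a\<^sup>2 \<le> (norm u)\<^sup>2"
      using a by (simp add: divide_le_eq power_mult_distrib mult.commute)
    then have "\<delta> t * ((norm v)\<^sup>2 / a\<^sup>2) \<le> \<delta> t * (norm u)\<^sup>2"
      using \<delta>_pos[OF t] by (intro mult_left_mono) simp_all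
    also have "\<dots> \<le> (norm v)\<^sup>2 - (norm (\<psi> t \<cdot> v))\<^sup>2"
      using gap[OF t, of u] \<psi>A[OF t, of u] v by simp
    finally show "(norm (\<psi> t \<cdot> v))\<^sup>2 \<le> (1 - \<delta> t / a\<^sup>2) * (norm v)\<^sup>2"
      by (simp add: algebra_simps)
  qed
  moreover have "\<exists>D. (\<psi> has_derivative (\<lambda>z. z *\<^sub>C D)) (at t0)" if t0: "cmod t0 * s < 1" for t0
  proof -
    \<comment> \<open>The identity \<open>\<psi> t - \<psi> t0 = (t - t0) G (\<psi> t)\<close>
      involves the inverse at \<open>t0\<close> only. Boundedness of \<open>G\<close> on the ball
      first gives continuity of \<open>\<psi>\<close> at \<open>t0\<close>, and then
      \<open>G (\<psi> t)\<close> converges to the derivative.\<close>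
    define G where "G Y = (H - Y \<circ>\<^sub>C (A \<circ>\<^sub>C H)) \<circ>\<^sub>C R t0" for Y :: "('a, 'b) cblinfun"
    have diff: "\<psi> t - \<psi> t0 = (t - t0) *\<^sub>C G (\<psi> t)" if t: "cmod t * s < 1" for t
    proof (rule cblinfun_eqI)
      fix u
      define x where "x = R t0 \<cdot> u"
      have u: "u = At t0 \<cdot> x" by (simp add: x_def AR[OF t0])
      have "At t0 \<cdot> x = At t \<cdot> x - (t - t0) *\<^sub>C A \<cdot> H \<cdot> x"
        by (simp add: At_def scaleC_diff_left)
      then have "\<psi> t \<cdot> u = Bt t \<cdot> x - (t - t0) *\<^sub>C \<psi> t \<cdot> A \<cdot> H \<cdot> x"
        unfolding u by (simp add: cblinfun_apply_right \<psi>A[OF t])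
      moreover have "\<psi> t0 \<cdot> u = Bt t0 \<cdot> x" by (simp add: u \<psi>A[OF t0])
      ultimately show "(\<psi> t - \<psi> t0) \<cdot> u = ((t - t0) *\<^sub>C G (\<psi> t)) \<cdot> u"
        by (simp add: G_def Bt_def x_def[symmetric] scaleC_diff_left scaleC_diff_right algebra_simps)
    qed
    have "open {t. cmod t * s < 1}" by (intro open_Collect_less continuous_intros)
    then have ev: "\<forall>\<^sub>F t in at t0. cmod t * s < 1"
      using t0 by (auto simp: eventually_at_topological)
    define K where "K = (norm H + norm (A \<circ>\<^sub>C H)) * norm (R t0)"
    have G_le: "norm (G Y) \<le> K" if "norm Y < 1" for Y
    proof -
      have "norm (H - Y \<circ>\<^sub>C (A \<circ>\<^sub>C H)) \<le> norm H + norm (Y \<circ>\<^sub>C (A \<circ>\<^sub>C H))"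
        by (rule norm_triangle_ineq4)
      also have "\<dots> \<le> norm H + norm (A \<circ>\<^sub>C H)"
        using norm_cblinfun_compose_le[of Y "A \<circ>\<^sub>C H"] that
        by (smt (verit) mult_left_le_one_le norm_ge_zero)
      finally show ?thesis
        unfolding G_def K_def
        by (meson mult_right_mono norm_cblinfun_compose_le norm_ge_zero order_trans)
    qed
    have "((\<lambda>t. \<psi> t - \<psi> t0) \<longlongrightarrow> 0) (at t0)"
    proof (rule Lim_null_comparison)
      show "\<forall>\<^sub>F t in at t0. norm (\<psi> t - \<psi> t0) \<le> cmod (t - t0) * K"
        using ev
      proof eventually_elim
        case (elim t)
        then show ?case using G_le[OF bound[OF elim]]
          by (simp add: diff norm_scaleC mult_left_mono)
      qed
      have "((\<lambda>t. cmod (t - t0) * K) \<longlongrightarrow> cmod (t0 - t0) * K) (at t0)"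
        by (intro tendsto_intros)
      then show "((\<lambda>t. cmod (t - t0) * K) \<longlongrightarrow> 0) (at t0)" by simp
    qed
    then have "(\<psi> \<longlongrightarrow> \<psi> t0) (at t0)" by (simp add: LIM_zero_iff)
    then have "((\<lambda>t. G (\<psi> t)) \<longlongrightarrow> G (\<psi> t0)) (at t0)"
      unfolding G_def by (intro tendsto_cblinfun_compose tendsto_intros)
    moreover have "\<forall>\<^sub>F t in at t0. inverse (t - t0) *\<^sub>C (\<psi> t - \<psi> t0) = G (\<psi> t)"
      using ev eventually_neq_at_within[of t0 t0 UNIV]
    proof eventually_elim
      case (elim t)
      then show ?case by (simp add: diff scaleC_scaleC scaleC_one)
    qed
    ultimately have "((\<lambda>t. inverse (t - t0) *\<^sub>C (\<psi> t - \<psi> t0)) \<longlongrightarrow> G (\<psi> t0)) (at t0)"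
      by (simp add: tendsto_cong)
    then show ?thesis unfolding has_derivative_scaleC_iff[symmetric] by blast
  qed
  ultimately show ?thesis by blast
qed

section \<open>The Schwarz lemma and invariance under holomorphic maps\<close>

lemma norm_cblinfun_apply_le_mult: "norm u \<le> b \<Longrightarrow> norm (X \<cdot> u) \<le> norm X * b"
  by (meson mult_left_mono norm_cblinfun_apply_le norm_ge_zero order_trans)

text \<open>The classical lemma asks for values strictly inside the unit disc, so it is applied to
  \<open>f / c\<close> for every \<open>c > M\<close>, and \<open>c\<close> then decreases to
  \<open>M\<close>.\<close>

lemma Schwarz_bound:
  assumes hol: "f holomorphic_on ball 0 1" and f0: "f 0 = 0"
    and bound: "\<And>z. cmod z < 1 \<Longrightarrow> cmod (f z) \<le> M" and z: "cmod z < 1"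
  shows "cmod (f z) \<le> M * cmod z"
proof (cases "z = 0")
  case False
  have "cmod (f z) / cmod z \<le> c" if c: "M < c" for c
  proof -
    have "0 \<le> M" using bound[of 0] f0 by simp
    then have c0: "0 < c" using c by simp
    have "cmod (f z / c) \<le> cmod z"
    proof (rule Schwarz_Lemma(1)[where f = "\<lambda>z. f z / c"])
      show "(\<lambda>z. f z / complex_of_real c) holomorphic_on ball 0 1"
        using c0 by (intro holomorphic_intros hol) simp
      show "cmod (f w / complex_of_real c) < 1" if "cmod w < 1" for w
        using bound[OF that] c c0 by (simp add: norm_divide)
    qed (use f0 z in simp_all)
    then show ?thesis using c0 False by (simp add: norm_divide field_simps)
  qed
  then have "cmod (f z) / cmod z \<le> M" by (rule dense_ge)
  then show ?thesis using False by (simp add: field_simps)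
qed (simp add: f0)

text \<open>An operator-valued Schwarz lemma: the curve is reduced to one scalar function vanishing
  at 0, and its growth bound becomes a lower bound for the defect at parameter
  \<open>s\<close>.\<close>

lemma disc_imp_near:
  fixes \<phi> :: "complex \<Rightarrow> ('a::complex_inner, 'b::complex_inner) cblinfun"
  assumes fd: "\<exists>Basis :: 'a set. finite_dimensional_vector_space scaleC Basis"
    and bound: "\<And>z. cmod z < 1 \<Longrightarrow> norm (\<phi> z) < 1"
    and diff: "\<And>z. cmod z < 1 \<Longrightarrow> \<exists>D. (\<phi> has_derivative (\<lambda>t. t *\<^sub>C D)) (at z)"
    and s: "0 < s" "s < 1"
  shows "near (1 - s\<^sup>2) (\<phi> 0) (\<phi> (of_real s))"
proof -
  define Z where "Z = \<phi> 0"
  have Z: "norm Z < 1" using bound[of 0] by (simp add: Z_def)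
  obtain A :: "('b, 'a) cblinfun"
    where A: "\<And>w h. cinner w (A \<cdot> h) = cinner (Z \<cdot> w) h" and normA: "norm A \<le> norm Z"
    using adjoint_exists[OF fd, of Z] by blast
  have A1: "norm A \<le> 1" using normA Z by simp
  have below: "(1 - norm Z) * norm u \<le> norm ((cblinfun_id - A \<circ>\<^sub>C \<phi> z) \<cdot> u)" if "cmod z < 1" for z u
  proof (rule id_minus_contraction_below)
    have "norm (A \<circ>\<^sub>C \<phi> z) \<le> norm A * norm (\<phi> z)" by (rule norm_cblinfun_compose_le)
    also have "\<dots> \<le> norm A"
      using bound[OF that] by (intro mult_left_le) simp_all
    finally show "norm (A \<circ>\<^sub>C \<phi> z) \<le> norm Z" using normA by simp
  qed
  define R where "R z = cblinfun_inv (cblinfun_id - A \<circ>\<^sub>C \<phi> z)" for z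
  have AR: "(cblinfun_id - A \<circ>\<^sub>C \<phi> z) \<cdot> R z \<cdot> u = u"
    and RA: "R z \<cdot> (cblinfun_id - A \<circ>\<^sub>C \<phi> z) \<cdot> u = u" if "cmod z < 1" for z u
    unfolding R_def by (rule bounded_below_inverse[OF fd _ below[OF that]], simp add: Z)+
  let ?X = "\<phi> (of_real s)"
  have s1: "cmod (of_real s) < 1" using s by simp
  show ?thesis
    unfolding near_def Z_def[symmetric]
  proof (intro allI)
    fix w u
    \<comment> \<open>\<open>v\<close> is normalized so that \<open>(\<phi> z v z, v z) = (Z w0, w0) + (h z, A h z)\<close>, a decomposition that is
      orthogonal for the indefinite form \<open>|v|\<^sup>2 - |y|\<^sup>2\<close>. As \<open>h\<close> vanishes at \<open>0\<close>, the scalar Schwarz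
      lemma applies to it.\<close>
    define a where "a = (cblinfun_id - A \<circ>\<^sub>C ?X) \<cdot> u"
    define v where "v z = R z \<cdot> a" for z
    define w0 where "w0 = v 0"
    define y where "y z = \<phi> z \<cdot> v z" for z
    define h where "h z = y z - Z \<cdot> w0" for z
    have v: "v z - A \<cdot> y z = a" if "cmod z < 1" for z
      using AR[OF that, of a] by (simp add: v_def y_def)
    have vs: "v (of_real s) = u"
      unfolding v_def a_def by (rule RA[OF s1])
    have w0: "w0 - A \<cdot> Z \<cdot> w0 = a" using v[of 0] by (simp add: w0_def Z_def y_def)
    have vh: "w0 + A \<cdot> h z = v z" if "cmod z < 1" for z
      using v[OF that] w0 by (simp add: h_def cblinfun_apply_right algebra_simps)
    define N where "N = defect Z w0"
    have defh: "defect (\<phi> z) (v z) = N - defect A (h z)" if "cmod z < 1" for z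
      using adjoint_defect_identity[OF A, of w0 1 "h z"] vh[OF that]
      by (simp add: scaleC_one N_def defect_def h_def y_def)
    \<comment> \<open>The defect of \<open>\<phi> z\<close> is nonnegative on the open disc, which
      bounds \<open>h z\<close> in the semidefinite norm of \<open>iform A A\<close>.\<close>
    have hN: "defect A (h z) \<le> N" if "cmod z < 1" for z
      using defh[OF that] defect_nonneg[of "\<phi> z" "v z"] bound[OF that] by simp
    have N0: "0 \<le> N" unfolding N_def using Z by (intro defect_nonneg) simp
    define S where "S = defect A (h (of_real s))"
    have S0: "0 \<le> S" unfolding S_def by (rule defect_nonneg[OF A1])
    \<comment> \<open>Pairing with the fixed vector \<open>h s\<close> makes the problem scalar.
      Since \<open>F s = S\<close> and \<open>F\<close> is bounded by \<open>sqrt (S * N)\<close>,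
      Schwarz gives \<open>S \<le> s * sqrt (S * N)\<close>, hence
      \<open>S \<le> s^2 * N\<close>.\<close>
    define F where "F z = iform A A (h (of_real s)) (h z)" for z
    have v_le: "norm (v z) \<le> norm a / (1 - norm Z)" if "cmod z < 1" for z
    proof -
      have "(1 - norm Z) * norm (v z) \<le> norm a"
        using below[OF that, of "v z"] by (simp only: v_def AR[OF that])
      then show ?thesis using Z by (simp add: pos_le_divide_eq mult.commute)
    qed
    have "F field_differentiable at z0" if z0: "cmod z0 < 1" for z0
    proof -
      obtain D where D: "(\<phi> has_derivative (\<lambda>t. t *\<^sub>C D)) (at z0)" using diff[OF z0] by blast
      define q where "q z = inverse (z - z0) *\<^sub>C (\<phi> z - \<phi> z0)" for z
      have q: "(q \<longlongrightarrow> D) (at z0)"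
        using D unfolding q_def has_derivative_scaleC_iff .
      have \<phi>: "(\<phi> \<longlongrightarrow> \<phi> z0) (at z0)"
        using has_derivative_continuous[OF D] by (simp add: continuous_within)
      have ev: "\<forall>\<^sub>F z in at z0. cmod z < 1"
      proof -
        have "open {z. cmod z < 1}" by (intro open_Collect_less continuous_intros)
        then show ?thesis using z0 by (auto simp: eventually_at_topological)
      qed
      \<comment> \<open>Resolvent identity for \<open>v z = R z a\<close>; with the bound
        \<open>v_le\<close> it yields continuity of \<open>v\<close>.\<close>
      have vdiff: "v z - v z0 = R z0 \<cdot> A \<cdot> (\<phi> z - \<phi> z0) \<cdot> v z" if "cmod z < 1" for z
      proof -
        have "(cblinfun_id - A \<circ>\<^sub>C \<phi> z0) \<cdot> (v z - v z0)
            = (v z - A \<cdot> y z) - (v z0 - A \<cdot> y z0) + A \<cdot> (\<phi> z - \<phi> z0) \<cdot> v z"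
          by (simp add: y_def cblinfun_apply_right)
        also have "\<dots> = A \<cdot> (\<phi> z - \<phi> z0) \<cdot> v z"
          by (simp only: v[OF that] v[OF z0] diff_self add_0)
        finally have "(cblinfun_id - A \<circ>\<^sub>C \<phi> z0) \<cdot> (v z - v z0) = A \<cdot> (\<phi> z - \<phi> z0) \<cdot> v z" .
        then show ?thesis using RA[OF z0, of "v z - v z0"] by simp
      qed
      have "((\<lambda>z. v z - v z0) \<longlongrightarrow> 0) (at z0)"
      proof (rule Lim_null_comparison)
        let ?K = "norm (R z0) * norm A" and ?L = "norm a / (1 - norm Z)"
        show "\<forall>\<^sub>F z in at z0. norm (v z - v z0) \<le> ?K * (norm (\<phi> z - \<phi> z0) * ?L)"
          using ev
        proof eventually_elim
          case (elim z)
          have "norm (v z - v z0) \<le> norm (R z0) * (norm A * (norm (\<phi> z - \<phi> z0) * norm (v z)))"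
            unfolding vdiff[OF elim] by (intro norm_cblinfun_apply_le_mult norm_cblinfun_apply_le)
          also have "\<dots> \<le> norm (R z0) * (norm A * (norm (\<phi> z - \<phi> z0) * ?L))"
            by (intro mult_left_mono v_le elim norm_ge_zero)
          finally show ?case by (simp add: mult.assoc)
        qed
        have "((\<lambda>z. ?K * (norm (\<phi> z - \<phi> z0) * ?L)) \<longlongrightarrow> ?K * (norm (\<phi> z0 - \<phi> z0) * ?L)) (at z0)"
          by (intro tendsto_intros \<phi>)
        then show "((\<lambda>z. ?K * (norm (\<phi> z - \<phi> z0) * ?L)) \<longlongrightarrow> 0) (at z0)" by simp
      qed
      then have vlim: "(v \<longlongrightarrow> v z0) (at z0)" by (simp add: LIM_zero_iff)
      \<comment> \<open>The difference quotient of \<open>y\<close>, with the increment of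
        \<open>v\<close> expressed by \<open>vdiff\<close>. Only \<open>q\<close> and
        \<open>v\<close> depend on \<open>z\<close>, and both have limits.\<close>
      let ?y' = "\<lambda>z. q z \<cdot> v z + \<phi> z0 \<cdot> R z0 \<cdot> A \<cdot> q z \<cdot> v z"
      have ydiff: "y z - y z0 = (z - z0) *\<^sub>C ?y' z" if "cmod z < 1" "z \<noteq> z0" for z
      proof -
        have "\<phi> z - \<phi> z0 = (z - z0) *\<^sub>C q z"
          using that(2) by (simp add: q_def scaleC_scaleC scaleC_one)
        then have q': "(\<phi> z - \<phi> z0) \<cdot> v z = (z - z0) *\<^sub>C q z \<cdot> v z" by simp
        have "y z - y z0 = (\<phi> z - \<phi> z0) \<cdot> v z + \<phi> z0 \<cdot> (v z - v z0)"
          by (simp add: y_def cblinfun_apply_right)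
        also have "\<dots> = (z - z0) *\<^sub>C ?y' z"
          unfolding vdiff[OF that(1)] q' by (simp add: cblinfun_apply_right scaleC_add_right)
        finally show ?thesis .
      qed
      have "((\<lambda>z. iform A A (h (of_real s)) (?y' z)) \<longlongrightarrow>
          iform A A (h (of_real s)) (D \<cdot> v z0 + \<phi> z0 \<cdot> R z0 \<cdot> A \<cdot> D \<cdot> v z0)) (at z0)"
        unfolding iform_def
        by (intro tendsto_cinner tendsto_cblinfun_apply tendsto_intros q vlim)
      moreover have "\<forall>\<^sub>F z in at z0. (F z - F z0) / (z - z0) = iform A A (h (of_real s)) (?y' z)"
        using ev eventually_neq_at_within[of z0 z0 UNIV]
      proof eventually_elim
        case (elim z)
        have "F z - F z0 = iform A A (h (of_real s)) (y z - y z0)"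
          by (simp add: F_def h_def iform_def cblinfun_apply_right cinner_diff_right)
        also have "\<dots> = (z - z0) * iform A A (h (of_real s)) (?y' z)"
          unfolding ydiff[OF elim]
          by (simp only: iform_def cblinfun_apply_scaleC_right cinner_scaleC_right right_diff_distrib)
        finally show ?case using elim by simp
      qed
      ultimately have "((\<lambda>z. (F z - F z0) / (z - z0)) \<longlongrightarrow>
          iform A A (h (of_real s)) (D \<cdot> v z0 + \<phi> z0 \<cdot> R z0 \<cdot> A \<cdot> D \<cdot> v z0)) (at z0)"
        by (simp add: tendsto_cong)
      then show ?thesis unfolding field_differentiable_def has_field_derivative_iff by blast
    qed
    then have hol: "F holomorphic_on ball 0 1"
      by (auto simp: holomorphic_on_def intro: field_differentiable_at_within)
    have F0: "F 0 = 0"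
      by (simp add: F_def iform_def h_def y_def Z_def w0_def cblinfun_apply_right)
    have Fle: "cmod (F z) \<le> sqrt (S * N)" if "cmod z < 1" for z
    proof (rule real_le_rsqrt)
      have "(cmod (F z))\<^sup>2 \<le> S * defect A (h z)"
        unfolding F_def S_def by (rule iform_Cauchy_Schwarz[OF A1])
      also have "\<dots> \<le> S * N" by (intro mult_left_mono hN that S0)
      finally show "(cmod (F z))\<^sup>2 \<le> S * N" .
    qed
    have "S \<le> sqrt (S * N) * s"
      using Schwarz_bound[OF hol F0 Fle s1] s S0 by (simp add: F_def iform_self S_def[symmetric])
    then have "S\<^sup>2 \<le> (sqrt (S * N) * s)\<^sup>2" using S0 by (rule power_mono)
    then have SS: "S * S \<le> S * (s\<^sup>2 * N)"
      using S0 N0 by (simp add: power_mult_distrib power2_eq_square mult_ac)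
    have "S \<le> s\<^sup>2 * N"
    proof (cases "S = 0")
      case False
      then show ?thesis using SS S0 by simp
    qed (simp add: N0)
    then have gap: "(1 - s\<^sup>2) * N \<le> defect ?X u"
      using defh[OF s1] vs by (simp add: S_def algebra_simps)
    \<comment> \<open>Through \<open>a\<close> the mixed form becomes \<open>iform Z Z w w0\<close>,
      to which Cauchy-Schwarz applies with \<open>N = defect Z w0\<close>.\<close>
    have "iform Z ?X w u = cinner w a"
      by (simp add: iform_def a_def cinner_diff_right A)
    also have "\<dots> = iform Z Z w w0"
      by (simp add: iform_def w0[symmetric] cinner_diff_right A)
    finally have "(cmod (iform Z ?X w u))\<^sup>2 \<le> defect Z w * N"
      using iform_Cauchy_Schwarz[of Z w w0] Z by (simp add: N_def)
    then have "(1 - s\<^sup>2) * (cmod (iform Z ?X w u))\<^sup>2 \<le> (1 - s\<^sup>2) * (defect Z w * N)"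
      using s by (intro mult_left_mono) (simp_all add: power_le_one)
    also have "\<dots> = defect Z w * ((1 - s\<^sup>2) * N)" by simp
    also have "\<dots> \<le> defect Z w * defect ?X u"
      using Z by (intro mult_left_mono gap defect_nonneg) simp
    finally show "(1 - s\<^sup>2) * (cmod (iform Z ?X w u))\<^sup>2 \<le> defect Z w * defect ?X u" .
  qed
qed

text \<open>Composing \<open>f\<close> with the disc through \<open>Z\<close> and \<open>X\<close>
  gives a disc through \<open>f Z\<close> and \<open>f X\<close>, to which the Schwarz argument
  applies. Coefficients \<open>k' < k\<close> are used so that \<open>0 < s < 1\<close> whenever
  \<open>k' > 0\<close>.\<close>

lemma near_holomorphic_image:
  fixes f :: "('a::complex_inner, 'b::complex_inner) cblinfun \<Rightarrow>
    ('c::complex_inner, 'd::complex_inner) cblinfun"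
  assumes fd: "\<exists>Basis :: 'a set. finite_dimensional_vector_space scaleC Basis"
    "\<exists>Basis :: 'c set. finite_dimensional_vector_space scaleC Basis"
    and hol: "frechet_holomorphic_on f {X. norm X < 1}"
    and into: "\<And>X. norm X < 1 \<Longrightarrow> norm (f X) < 1"
    and Z: "norm Z < 1" and X: "norm X < 1" and near: "near k Z X" and k: "k \<le> 1"
  shows "near k (f Z) (f X)"
proof (rule near_limit)
  fix k' :: real
  assume "k' < k"
  then have k': "near k' Z X" "k' < 1" using near_mono[OF near, of k'] k by simp_all
  show "near k' (f Z) (f X)"
  proof (cases "k' \<le> 0")
    case True
    then show ?thesis using into[OF Z] into[OF X] by (intro near_nonpos) simp_all
  next
    case False
    define s where "s = sqrt (1 - k')"
    have s: "0 < s" "s < 1" "k' = 1 - s\<^sup>2" using False k' by (simp_all add: s_def)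
    from k' have near': "near (1 - s\<^sup>2) Z X" by (simp add: s(3))
    obtain \<psi> where \<psi>: "\<psi> 0 = Z" "\<psi> 1 = X"
      "\<And>t. cmod t * s < 1 \<Longrightarrow> norm (\<psi> t) < 1"
      "\<And>t. cmod t * s < 1 \<Longrightarrow> \<exists>D. (\<psi> has_derivative (\<lambda>z. z *\<^sub>C D)) (at t)"
      using near_imp_disc[OF fd(1) Z X near' s(1,2)] by blast
    \<comment> \<open>Division by \<open>s\<close> maps the unit disc onto the domain of
      \<open>\<psi>\<close> and the parameter \<open>s\<close> to 1.\<close>
    define \<phi> where "\<phi> z = f (\<psi> (z / of_real s))" for z :: complex
    have small: "cmod (z / of_real s) * s < 1" if "cmod z < 1" for z :: complex
      using that s by (simp add: norm_divide)
    have "near (1 - s\<^sup>2) (\<phi> 0) (\<phi> (of_real s))"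
    proof (rule disc_imp_near[where \<phi> = \<phi>, OF fd(2) _ _ s(1,2)])
      fix z :: complex assume z: "cmod z < 1"
      show "norm (\<phi> z) < 1" unfolding \<phi>_def by (intro into \<psi> small z)
      obtain D where D: "(\<psi> has_derivative (\<lambda>z. z *\<^sub>C D)) (at (z / of_real s))"
        using \<psi>(4)[OF small[OF z]] by blast
      obtain f' where f': "bounded_clinear f'" "(f has_derivative f') (at (\<psi> (z / of_real s)))"
        using hol \<psi>(3)[OF small[OF z]] by (auto simp: frechet_holomorphic_on_def)
      have "((\<lambda>z::complex. z / of_real s) has_derivative (\<lambda>z. z / of_real s)) (at z)"
        using s by (auto intro!: derivative_eq_intros)
      from has_derivative_compose[OF has_derivative_compose[OF this D] f'(2)]
      have "(\<phi> has_derivative (\<lambda>t. f' ((t / of_real s) *\<^sub>C D))) (at z)"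
        by (simp add: \<phi>_def[abs_def])
      \<comment> \<open>Complex linearity of the Frechet derivative \<open>f'\<close> lets the
        scalar \<open>t\<close> be pulled out.\<close>
      moreover have "(\<lambda>t. f' ((t / of_real s) *\<^sub>C D)) = (\<lambda>t::complex. t *\<^sub>C f' ((1 / of_real s) *\<^sub>C D))"
      proof (rule ext)
        show "f' ((t / of_real s) *\<^sub>C D) = t *\<^sub>C f' ((1 / of_real s) *\<^sub>C D)" for t :: complex
        proof -
          have "(t / of_real s) *\<^sub>C D = t *\<^sub>C (1 / of_real s) *\<^sub>C D" by (simp add: scaleC_scaleC)
          then show ?thesis using f'(1) by (simp only: bounded_clinear_def)
        qed
      qed
      ultimately show "\<exists>D. (\<phi> has_derivative (\<lambda>t. t *\<^sub>C D)) (at z)" by (simp only:) blast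
    qed
    then show ?thesis using \<psi>(1,2) s by (simp add: \<phi>_def)
  qed
qed

section \<open>Compactness\<close>

lemma norm_orthonormal_basis: "orthonormal_basis E \<Longrightarrow> e \<in> E \<Longrightarrow> norm e = 1"
  using cinner_self[of e] by (simp add: orthonormal_basis_def norm_eq_sqrt_cinner)

lemma orthonormal_basis_expansion:
  assumes "orthonormal_basis E"
  shows "X \<cdot> u = (\<Sum>e\<in>E. cinner e u *\<^sub>C X \<cdot> e)"
proof -
  have "u = (\<Sum>e\<in>E. cinner e u *\<^sub>C e)" using assms unfolding orthonormal_basis_def by blast
  then have "X \<cdot> u = X \<cdot> (\<Sum>e\<in>E. cinner e u *\<^sub>C e)" by simp
  then show ?thesis by (simp add: cblinfun_apply_sum_right cblinfun_apply_scaleC_right)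
qed

lemma norm_sum_orthonormal_le:
  fixes f :: "'a::complex_inner \<Rightarrow> 'b::complex_normed_vector"
  assumes "orthonormal_basis E"
  shows "norm (\<Sum>e\<in>E. cinner e u *\<^sub>C f e) \<le> (\<Sum>e\<in>E. norm (f e)) * norm u"
proof -
  have "norm (\<Sum>e\<in>E. cinner e u *\<^sub>C f e) \<le> (\<Sum>e\<in>E. norm (cinner e u *\<^sub>C f e))"
    by (rule norm_sum)
  also have "\<dots> \<le> (\<Sum>e\<in>E. norm (f e) * norm u)"
  proof (rule sum_mono)
    fix e assume "e \<in> E"
    then have "cmod (cinner e u) \<le> norm u"
      using cmod_cinner_le[of e u] norm_orthonormal_basis[OF assms] by simp
    then show "norm (cinner e u *\<^sub>C f e) \<le> norm (f e) * norm u"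
      by (simp add: norm_scaleC mult.commute[of _ "norm u"] mult_right_mono)
  qed
  finally show ?thesis by (simp add: sum_distrib_right)
qed

text \<open>The squared Hilbert-Schmidt norm \<open>q\<close> satisfies the parallelogram law, which
  the operator norm in general lacks. As in the projection theorem, near-minimizers of
  \<open>q\<close> on the sets \<open>C n\<close> are Cauchy; finiteness of \<open>E\<close> turns
  convergence on basis vectors into convergence in operator norm.\<close>

lemma nested_closed_convex_inter:
  fixes C :: "nat \<Rightarrow> ('a::complex_inner, 'b::chilbert_space) cblinfun set"
  assumes fd: "\<exists>Basis :: 'a set. finite_dimensional_vector_space scaleC Basis"
    and closed: "\<And>n. closed (C n)" and convex: "\<And>n. convex (C n)" and ne: "\<And>n. C n \<noteq> {}"
    and dec: "decseq C" and bounded: "\<And>X. X \<in> C 0 \<Longrightarrow> norm X \<le> b"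
  shows "(\<Inter>n. C n) \<noteq> {}"
proof -
  obtain E :: "'a set" where E: "orthonormal_basis E" using orthonormal_basis_exists[OF fd] .
  define q where "q X = (\<Sum>e\<in>E. (norm (X \<cdot> e))\<^sup>2)" for X :: "('a, 'b) cblinfun"
  have q0: "0 \<le> q X" for X by (simp add: q_def sum_nonneg)
  have par: "q (X - Y) = 2 * q X + 2 * q Y - 4 * q ((1/2) *\<^sub>R X + (1/2) *\<^sub>R Y)" for X Y
  proof -
    have "(norm (x - y))\<^sup>2 = 2 * (norm x)\<^sup>2 + 2 * (norm y)\<^sup>2 - 4 * (norm ((1/2) *\<^sub>R x + (1/2) *\<^sub>R y))\<^sup>2"
      for x y :: 'b
    proof -
      have "4 * (norm ((1/2) *\<^sub>R x + (1/2) *\<^sub>R y))\<^sup>2 = (norm (x + y))\<^sup>2"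
        by (simp add: scaleR_add_right[symmetric] power_mult_distrib power2_eq_square)
      then show ?thesis by (simp add: norm_add_sq norm_diff_sq)
    qed
    then show ?thesis
      by (simp add: q_def sum.distrib sum_subtractf sum_distrib_left)
  qed
  define p where "p n = Inf (q ` C n)" for n
  have bdd: "bdd_below (q ` C n)" for n using q0 by (auto intro: bdd_belowI[of _ 0])
  have p_le: "p n \<le> q X" if "X \<in> C n" for n X
    unfolding p_def using bdd that by (intro cInf_lower) simp_all
  have inc: "incseq p"
    unfolding incseq_def p_def
    using dec ne bdd by (intro allI impI cInf_superset_mono image_mono) (auto simp: decseq_def)
  have "p n \<le> (\<Sum>e\<in>E. (b * norm e)\<^sup>2)" for n
  proof -
    obtain X where X: "X \<in> C n" using ne by blast
    then have "norm X \<le> b" using dec bounded by (auto simp: decseq_def)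
    then have "norm (X \<cdot> e) \<le> b * norm e" for e
      by (meson mult_right_mono norm_cblinfun_apply_le norm_ge_zero order_trans)
    then have "q X \<le> (\<Sum>e\<in>E. (b * norm e)\<^sup>2)"
      unfolding q_def by (intro sum_mono power_mono) simp_all
    with p_le[OF X] show ?thesis by linarith
  qed
  then have "\<forall>n. p n \<le> (\<Sum>e\<in>E. (b * norm e)\<^sup>2)" ..
  from incseq_convergent[OF inc this]
  obtain L where L: "p \<longlonglongrightarrow> L" "\<forall>n. p n \<le> L" .
  define i where "i n = inverse (real (Suc n))" for n
  have "\<exists>X\<in>C n. q X < p n + i n" for n
    using cInf_lessD[of "q ` C n" "p n + i n"] ne
    by (auto simp: p_def[symmetric] i_def)
  then obtain x where x: "\<And>n. x n \<in> C n" "\<And>n. q (x n) < p n + i n"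
    by metis
  \<comment> \<open>Obtained from the parallelogram law: the midpoint of \<open>x n\<close> and
    \<open>x m\<close> lies in \<open>C n\<close>, so its \<open>q\<close> is at least
    \<open>p n\<close>, while \<open>q (x m)\<close> is below \<open>L + i n\<close> for
    \<open>m \<ge> n\<close>.\<close>
  define \<epsilon> where "\<epsilon> n = 2 * (L - p n) + 4 * i n" for n
  have "(\<lambda>n. 2 * (L - p n) + 4 * i n) \<longlonglongrightarrow> 2 * (L - L) + 4 * 0"
    unfolding i_def by (intro tendsto_intros L LIMSEQ_inverse_real_of_nat)
  then have \<epsilon>: "\<epsilon> \<longlonglongrightarrow> 0" by (simp add: \<epsilon>_def[abs_def])
  have dist_le: "q (x n - x m) \<le> \<epsilon> n" if "n \<le> m" for n m
  proof -
    have xm: "x m \<in> C n" using x(1)[of m] dec that by (auto simp: decseq_def)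
    define M where "M = (1/2) *\<^sub>R x n + (1/2) *\<^sub>R x m"
    have "M \<in> C n"
      using convexD[OF convex x(1) xm, of "1/2" "1/2"] by (simp add: M_def)
    then have "p n \<le> q M" by (rule p_le)
    moreover have "i m \<le> i n" using that by (simp add: i_def)
    moreover have "q (x n - x m) = 2 * q (x n) + 2 * q (x m) - 4 * q M"
      unfolding M_def by (rule par)
    ultimately show ?thesis
      using x(2)[of n] x(2)[of m] L(2)[rule_format, of m] unfolding \<epsilon>_def by argo
  qed
  have "Cauchy (\<lambda>n. x n \<cdot> e)" if e: "e \<in> E" for e
  proof (rule metric_CauchyI)
    fix \<eta> :: real assume \<eta>: "0 < \<eta>"
    have "\<forall>\<^sub>F n in sequentially. \<epsilon> n < (\<eta> / 2)\<^sup>2"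
      using \<eta> by (intro order_tendstoD(2)[OF \<epsilon>] zero_less_power) simp
    then obtain N where N: "\<epsilon> N < (\<eta> / 2)\<^sup>2" by (auto simp: eventually_sequentially)
    have close: "norm (x N \<cdot> e - x m \<cdot> e) < \<eta> / 2" if "N \<le> m" for m
    proof (rule power2_less_imp_less)
      have "(norm ((x N - x m) \<cdot> e))\<^sup>2 \<le> q (x N - x m)"
        unfolding q_def using E e by (intro member_le_sum) (auto simp: orthonormal_basis_def)
      then show "(norm (x N \<cdot> e - x m \<cdot> e))\<^sup>2 < (\<eta> / 2)\<^sup>2"
        using dist_le[OF that] N by simp
    qed (use \<eta> in simp)
    show "\<exists>M. \<forall>m\<ge>M. \<forall>n\<ge>M. dist (x m \<cdot> e) (x n \<cdot> e) < \<eta>"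
    proof (intro exI allI impI)
      fix m n assume "N \<le> m" "N \<le> n"
      then show "dist (x m \<cdot> e) (x n \<cdot> e) < \<eta>"
        using dist_triangle_half_r[of "x N \<cdot> e" "x m \<cdot> e" \<eta> "x n \<cdot> e"] close
        by (simp add: dist_norm)
    qed
  qed
  then have "\<forall>e\<in>E. \<exists>l. (\<lambda>n. x n \<cdot> e) \<longlonglongrightarrow> l"
    by (simp add: Cauchy_convergent_iff convergent_def)
  from bchoice[OF this] obtain l where l: "\<And>e. e \<in> E \<Longrightarrow> (\<lambda>n. x n \<cdot> e) \<longlonglongrightarrow> l e" by blast
  \<comment> \<open>The linear extension of the limits on the basis.\<close>
  define y where "y u = (\<Sum>e\<in>E. cinner e u *\<^sub>C l e)" for u
  have "bounded_linear y"
  proof (rule bounded_linear_intro)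
    show "norm (y u) \<le> norm u * (\<Sum>e\<in>E. norm (l e))" for u
      using norm_sum_orthonormal_le[OF E, of u l] by (simp add: y_def mult.commute)
  qed (simp_all add: y_def cinner_add_right cinner_scaleC_right scaleC_add_left sum.distrib
        scaleR_scaleC scaleC_sum_right scaleC_scaleC)
  then have "bounded_clinear y"
    by (simp add: bounded_clinear_def y_def cinner_scaleC_right scaleC_sum_right scaleC_scaleC)
  then have Y: "CBlinfun y \<cdot> u = y u" for u by (simp add: cblinfun_apply_CBlinfun)
  have "(\<lambda>n. x n - CBlinfun y) \<longlonglongrightarrow> 0"
  proof (rule Lim_null_comparison)
    show "\<forall>\<^sub>F n in sequentially. norm (x n - CBlinfun y) \<le> (\<Sum>e\<in>E. norm (x n \<cdot> e - l e))"
    proof (intro always_eventually allI norm_cblinfun_le sum_nonneg norm_ge_zero)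
      fix n u
      have "(x n - CBlinfun y) \<cdot> u = (\<Sum>e\<in>E. cinner e u *\<^sub>C (x n \<cdot> e - l e))"
        using orthonormal_basis_expansion[OF E, of "x n" u]
        by (simp add: Y y_def scaleC_diff_right sum_subtractf)
      then show "norm ((x n - CBlinfun y) \<cdot> u) \<le> (\<Sum>e\<in>E. norm (x n \<cdot> e - l e)) * norm u"
        using norm_sum_orthonormal_le[OF E, of u "\<lambda>e. x n \<cdot> e - l e"] by simp
    qed
    have "(\<lambda>n. \<Sum>e\<in>E. norm (x n \<cdot> e - l e)) \<longlonglongrightarrow> (\<Sum>e\<in>E. norm (l e - l e))"
      by (intro tendsto_intros l)
    then show "(\<lambda>n. \<Sum>e\<in>E. norm (x n \<cdot> e - l e)) \<longlonglongrightarrow> 0" by simp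
  qed
  then have lim: "x \<longlonglongrightarrow> CBlinfun y" by (simp add: LIM_zero_iff)
  have "CBlinfun y \<in> C n" for n
  proof (rule Lim_in_closed_set[OF closed _ _ lim])
    show "\<forall>\<^sub>F m in sequentially. x m \<in> C n"
      using x(1) dec unfolding eventually_sequentially decseq_def by blast
  qed simp
  then show ?thesis by blast
qed

text \<open>Compactness of the unit sphere: Bolzano-Weierstrass is applied to one basis coefficient
  after another, and the norm passes to the limit.\<close>

lemma unit_vectors_subsequence:
  fixes u :: "nat \<Rightarrow> 'a::complex_inner"
  assumes fd: "\<exists>Basis :: 'a set. finite_dimensional_vector_space scaleC Basis"
    and u: "\<And>n. norm (u n) = 1"
  shows "\<exists>l r. strict_mono (r :: nat \<Rightarrow> nat) \<and> (\<lambda>n. u (r n)) \<longlonglongrightarrow> l \<and> norm l = 1"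
proof -
  obtain E :: "'a set" where E: "orthonormal_basis E" using orthonormal_basis_exists[OF fd] .
  have subseq: "\<exists>r :: nat \<Rightarrow> nat. strict_mono r \<and> (\<forall>e\<in>F. convergent (\<lambda>n. cinner e (u (r n))))"
    if "finite F" for F
    using that
  proof induction
    case empty
    show ?case using strict_mono_id by blast
  next
    case (insert f F)
    then obtain r :: "nat \<Rightarrow> nat" where r: "strict_mono r"
      "\<And>e. e \<in> F \<Longrightarrow> convergent (\<lambda>n. cinner e (u (r n)))" by blast
    have "cmod (cinner f (u (r n))) \<le> norm f" for n
      using cmod_cinner_le[of f "u (r n)"] u by simp
    then have "bounded (range (\<lambda>n. cinner f (u (r n))))"
      by (auto intro: boundedI)
    then obtain l r' where r': "strict_mono r'" "((\<lambda>n. cinner f (u (r n))) \<circ> r') \<longlonglongrightarrow> l"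
      using bounded_imp_convergent_subsequence by blast
    have "convergent (\<lambda>n. cinner e (u (r (r' n))))" if "e \<in> insert f F" for e
    proof (cases "e = f")
      case True
      then show ?thesis using r'(2) by (auto simp: convergent_def o_def)
    next
      case False
      then show ?thesis
        using convergent_subseq_convergent[OF r(2) r'(1)] that by (simp add: o_def)
    qed
    then show ?case using strict_mono_o[OF r(1) r'(1)] unfolding o_def
      by (intro exI[of _ "\<lambda>n. r (r' n)"]) simp
  qed
  have "finite E" using E by (simp add: orthonormal_basis_def)
  from subseq[OF this] obtain r :: "nat \<Rightarrow> nat" where r: "strict_mono r"
    "\<forall>e\<in>E. \<exists>l. (\<lambda>n. cinner e (u (r n))) \<longlonglongrightarrow> l"
    unfolding convergent_def by blast
  from bchoice[OF r(2)] obtain c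
    where c: "\<And>e. e \<in> E \<Longrightarrow> (\<lambda>n. cinner e (u (r n))) \<longlonglongrightarrow> c e" by blast
  have eq: "(\<Sum>e\<in>E. cinner e v *\<^sub>C e) = v" for v
    using E by (simp add: orthonormal_basis_def)
  have "(\<lambda>n. \<Sum>e\<in>E. cinner e (u (r n)) *\<^sub>C e) \<longlonglongrightarrow> (\<Sum>e\<in>E. c e *\<^sub>C e)"
    by (intro tendsto_sum tendsto_scaleC tendsto_const c)
  then have lim: "(\<lambda>n. u (r n)) \<longlonglongrightarrow> (\<Sum>e\<in>E. c e *\<^sub>C e)" by (simp add: eq)
  from tendsto_norm[OF this] have "norm (\<Sum>e\<in>E. c e *\<^sub>C e) = 1"
    by (simp add: u LIMSEQ_const_iff)
  with r(1) lim show ?thesis by blast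
qed

section \<open>Chebyshev centers\<close>

text \<open>The common kernel of all differences of elements of \<open>M\<close>; it is the whole
  space exactly if \<open>M\<close> has at most one point.\<close>

definition agree :: "('a::complex_normed_vector, 'b::complex_normed_vector) cblinfun set \<Rightarrow> 'a set"
  where "agree M = {u. \<forall>X\<in>M. \<forall>Y\<in>M. X \<cdot> u = Y \<cdot> u}"

lemma agree_mono: "M \<subseteq> M' \<Longrightarrow> agree M' \<subseteq> agree M"
  by (auto simp: agree_def)

lemma subspace_agree:
  assumes "finite_dimensional_vector_space scaleC (B :: 'a::complex_normed_vector set)"
  shows "module.subspace scaleC (agree (M :: ('a, 'b::complex_normed_vector) cblinfun set))"
proof -
  interpret fd: finite_dimensional_vector_space scaleC B by fact
  show ?thesis
  proof (rule fd.subspaceI)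
    show "0 \<in> agree M" by (simp add: agree_def cblinfun_apply_right)
    show "x + y \<in> agree M" if "x \<in> agree M" "y \<in> agree M" for x y
      using that unfolding agree_def mem_Collect_eq cblinfun_apply_right by metis
    show "c *\<^sub>C x \<in> agree M" if "x \<in> agree M" for c x
      using that unfolding agree_def mem_Collect_eq cblinfun_apply_right by metis
  qed
qed

text \<open>A finite \<open>F\<close> with \<open>agree F\<close> of least dimension works, since
  adding any further element of \<open>M\<close> cannot shrink this space. It permits averaging over
  finitely many centers in place of all of them.\<close>

lemma agree_finite_subset:
  fixes M :: "('a::complex_normed_vector, 'b::complex_normed_vector) cblinfun set"
  assumes fd: "\<exists>Basis :: 'a set. finite_dimensional_vector_space scaleC Basis" and ne: "M \<noteq> {}"
  shows "\<exists>F. finite F \<and> F \<noteq> {} \<and> F \<subseteq> M \<and> agree F = agree M"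
proof -
  from fd obtain B :: "'a set" where B: "finite_dimensional_vector_space scaleC B" by blast
  then interpret fd: finite_dimensional_vector_space scaleC B .
  define P where "P F \<longleftrightarrow> finite F \<and> F \<noteq> {} \<and> F \<subseteq> M" for F
  from ne obtain X0 where "P {X0}" by (auto simp: P_def)
  from ex_has_least_nat[of P, OF this, of "\<lambda>F. fd.dim (agree F)"]
  obtain F where F: "P F" and min: "\<And>G. P G \<Longrightarrow> fd.dim (agree F) \<le> fd.dim (agree G)" by blast
  have "agree F \<subseteq> agree M"
  proof
    fix u assume u: "u \<in> agree F"
    from F obtain X0 where X0: "X0 \<in> F" by (auto simp: P_def)
    have "X \<cdot> u = X0 \<cdot> u" if X: "X \<in> M" for X
    proof -
      have "P (insert X F)" using F X by (simp add: P_def)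
      then have "agree (insert X F) = agree F"
        by (intro fd.subspace_dim_equal subspace_agree[OF B] agree_mono min) auto
      with u have "u \<in> agree (insert X F)" by simp
      with X0 show ?thesis unfolding agree_def by blast
    qed
    then show "u \<in> agree M" by (simp add: agree_def)
  qed
  moreover have "agree M \<subseteq> agree F" using F by (intro agree_mono) (simp add: P_def)
  ultimately show ?thesis using F by (auto simp: P_def)
qed

section \<open>Quantitative forms of the convexity estimate\<close>

lemma sum_norm_sq_mean:
  fixes x :: "'i \<Rightarrow> 'a::complex_inner"
  assumes "(\<Sum>i\<in>I. x i) = real (card I) *\<^sub>R m"
  shows "(\<Sum>i\<in>I. (norm (x i))\<^sup>2) = real (card I) * (norm m)\<^sup>2 + (\<Sum>i\<in>I. (norm (x i - m))\<^sup>2)"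
proof -
  have "(\<Sum>i\<in>I. Re (cinner (x i) m)) = Re (cinner (\<Sum>i\<in>I. x i) m)"
    by (simp add: cinner_sum_left)
  also have "\<dots> = real (card I) * (norm m)\<^sup>2"
    by (simp add: assms scaleR_scaleC cinner_scaleC_left Re_cinner_self)
  finally show ?thesis
    by (simp add: norm_diff_sq sum.distrib sum_subtractf sum_distrib_left[symmetric])
qed

text \<open>Both sides are homogeneous of degree two in each of \<open>w\<close> and
  \<open>u\<close>. A zero vector would make both sides vanish, so a strict violation can be
  normalized.\<close>

lemma not_near_unit_vectors:
  fixes Y Z :: "('a::complex_inner, 'b::complex_inner) cblinfun"
  assumes "\<not> near k Y Z"
  shows "\<exists>w u. norm w = 1 \<and> norm u = 1 \<and> defect Y w * defect Z u < k * (cmod (iform Y Z w u))\<^sup>2"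
proof -
  obtain w u where wu: "defect Y w * defect Z u < k * (cmod (iform Y Z w u))\<^sup>2"
    using assms by (auto simp: near_def not_le)
  have nz: "w \<noteq> 0" "u \<noteq> 0"
    using wu by (auto simp: iform_def defect_def cblinfun_apply_right)
  define a b where "a = inverse (norm w)" and "b = inverse (norm u)"
  have ab: "0 < a" "0 < b" using nz by (simp_all add: a_def b_def)
  have d: "defect X (t *\<^sub>R v) = t\<^sup>2 * defect X v" for X :: "('a, 'b) cblinfun" and t v
    by (simp add: defect_def scaleR_scaleC cblinfun_apply_scaleC_right norm_scaleC
        power_mult_distrib right_diff_distrib)
  have i: "iform Y Z (a *\<^sub>R w) (b *\<^sub>R u) = of_real (a * b) * iform Y Z w u"
    by (simp add: iform_def scaleR_scaleC cblinfun_apply_scaleC_right cinner_scaleC_left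
        cinner_scaleC_right right_diff_distrib mult_ac)
  have "(a\<^sup>2 * b\<^sup>2) * (defect Y w * defect Z u) < (a\<^sup>2 * b\<^sup>2) * (k * (cmod (iform Y Z w u))\<^sup>2)"
    using ab wu by (intro mult_strict_left_mono) simp_all
  then have "defect Y (a *\<^sub>R w) * defect Z (b *\<^sub>R u) < k * (cmod (iform Y Z (a *\<^sub>R w) (b *\<^sub>R u)))\<^sup>2"
    unfolding d i by (simp add: norm_mult power_mult_distrib mult_ac)
  moreover have "norm (a *\<^sub>R w) = 1" "norm (b *\<^sub>R u) = 1"
    using nz by (simp_all add: a_def b_def)
  ultimately show ?thesis by blast
qed

lemma norm_iform_le_2:
  assumes "norm Y \<le> 1" "norm Z \<le> 1" "norm w = 1" "norm u = 1"
  shows "cmod (iform Y Z w u) \<le> 2"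
proof -
  have "norm (Y \<cdot> w) \<le> 1" "norm (Z \<cdot> u) \<le> 1"
    using norm_cblinfun_apply_le[of Y w] norm_cblinfun_apply_le[of Z u] assms by simp_all
  then have "norm (Y \<cdot> w) * norm (Z \<cdot> u) \<le> 1" by (simp add: mult_le_one)
  then have "cmod (cinner (Y \<cdot> w) (Z \<cdot> u)) \<le> 1"
    using cmod_cinner_le order_trans by blast
  moreover have "cmod (cinner w u) \<le> 1" using cmod_cinner_le[of w u] assms by simp
  ultimately show ?thesis
    unfolding iform_def using norm_triangle_ineq4[of "cinner w u" "cinner (Y \<cdot> w) (Z \<cdot> u)"] by linarith
qed

text \<open>Summing the inequalities for \<open>X \<in> F\<close> and comparing with the mean
  \<open>z\<close> leaves the variance of the vectors \<open>X u\<close> as a gain. If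
  \<open>z\<close> violates the relation for a \<open>k'\<close> close to \<open>k\<close>, this
  gain must be small. The factor 4 is the square of the bound in
  \<open>norm_iform_le_2\<close>.\<close>

lemma near_mean_variance:
  fixes F :: "('a::complex_inner, 'b::complex_inner) cblinfun set"
  assumes F: "finite F" and near: "\<And>X. X \<in> F \<Longrightarrow> near k Y X"
    and z: "z = inverse (real (card F)) *\<^sub>R (\<Sum>X\<in>F. X)"
    and k: "0 \<le> k" "k \<le> k'" and Y: "norm Y \<le> 1" and zn: "norm z \<le> 1"
    and w: "norm w = 1" and u: "norm u = 1"
    and far: "defect Y w * defect z u < k' * (cmod (iform Y z w u))\<^sup>2"
  shows "defect Y w * (\<Sum>X\<in>F. (norm (X \<cdot> u - z \<cdot> u))\<^sup>2) \<le> 4 * real (card F) * (k' - k)"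
proof (cases "F = {}")
  case False
  define N where "N = real (card F)"
  have N: "0 < N" using F False by (simp add: N_def card_gt_0_iff)
  let ?d = "defect Y w" and ?V = "\<Sum>X\<in>F. (norm (X \<cdot> u - z \<cdot> u))\<^sup>2"
  let ?c = "(cmod (iform Y z w u))\<^sup>2"
  have sumF: "(\<Sum>X\<in>F. X) = N *\<^sub>R z" using N by (simp add: z N_def)
  have sumu: "(\<Sum>X\<in>F. X \<cdot> v) = N *\<^sub>R z \<cdot> v" for v
    using arg_cong[OF sumF, of "\<lambda>X. X \<cdot> v"] by (simp add: cblinfun_apply_sum_left)
  have var: "(\<Sum>X\<in>F. (norm (X \<cdot> u))\<^sup>2) = N * (norm (z \<cdot> u))\<^sup>2 + ?V"
    unfolding N_def by (rule sum_norm_sq_mean) (simp add: sumu N_def)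
  have "N * ?c \<le> (\<Sum>X\<in>F. (cmod (iform Y X w u))\<^sup>2)"
  proof -
    have "(\<Sum>X\<in>F. cinner (Y \<cdot> w) (X \<cdot> u)) = of_real N * cinner (Y \<cdot> w) (z \<cdot> u)"
      by (simp add: cinner_sum_right[symmetric] sumu scaleR_scaleC cinner_scaleC_right)
    then have "(\<Sum>X\<in>F. iform Y X w u) = of_real N * iform Y z w u"
      by (simp add: iform_def sum_subtractf N_def right_diff_distrib)
    then have "N * cmod (iform Y z w u) = cmod (\<Sum>X\<in>F. iform Y X w u)"
      using N by (simp add: norm_mult)
    also have "\<dots> \<le> (\<Sum>X\<in>F. cmod (iform Y X w u))" by (rule norm_sum)
    finally have "(N * cmod (iform Y z w u))\<^sup>2 \<le> (\<Sum>X\<in>F. cmod (iform Y X w u))\<^sup>2"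
      using N by (intro power_mono) simp_all
    also have "\<dots> \<le> (\<Sum>X\<in>F. (cmod (iform Y X w u))\<^sup>2) * N"
      unfolding N_def by (rule sum_squared_le_sum_of_squares)
    finally have "N * (N * ?c) \<le> N * (\<Sum>X\<in>F. (cmod (iform Y X w u))\<^sup>2)"
      by (simp add: power2_eq_square mult_ac)
    then show ?thesis using N by simp
  qed
  then have "k * (N * ?c) \<le> k * (\<Sum>X\<in>F. (cmod (iform Y X w u))\<^sup>2)"
    using k(1) by (rule mult_left_mono)
  moreover have "k * (\<Sum>X\<in>F. (cmod (iform Y X w u))\<^sup>2) + ?d * (\<Sum>X\<in>F. (norm (X \<cdot> u))\<^sup>2) \<le> N * ?d"
  proof -
    have "k * (cmod (iform Y X w u))\<^sup>2 + ?d * (norm (X \<cdot> u))\<^sup>2 \<le> ?d" if "X \<in> F" for X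
      using near[OF that] u unfolding near_iff_quadratic by (metis mult.right_neutral one_power2)
    then have "(\<Sum>X\<in>F. k * (cmod (iform Y X w u))\<^sup>2 + ?d * (norm (X \<cdot> u))\<^sup>2) \<le> (\<Sum>X\<in>F. ?d)"
      by (rule sum_mono)
    then show ?thesis by (simp add: sum.distrib sum_distrib_left N_def)
  qed
  moreover have "N * (?d * (1 - (norm (z \<cdot> u))\<^sup>2)) \<le> N * (k' * ?c)"
    using far N u by (intro mult_left_mono) (simp_all add: defect_def)
  moreover have "?d * (N * (norm (z \<cdot> u))\<^sup>2 + ?V) = N * ?d - N * (?d * (1 - (norm (z \<cdot> u))\<^sup>2)) + ?d * ?V"
    by (simp add: algebra_simps)
  ultimately have "?d * ?V \<le> N * (k' * ?c) - k * (N * ?c)"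
    unfolding var by linarith
  also have "\<dots> = N * (k' - k) * ?c" by (simp add: algebra_simps)
  also have "\<dots> \<le> N * (k' - k) * 2\<^sup>2"
    using k N norm_iform_le_2[OF Y zn w u] by (intro mult_left_mono power_mono) simp_all
  finally show ?thesis by (simp add: N_def mult_ac)
qed simp

text \<open>If \<open>Y u\<close> is close to \<open>z u\<close>, then \<open>iform Y z w u\<close>
  is close to \<open>iform Y Y w u\<close>, where Cauchy-Schwarz holds with constant 1; so a
  violation with \<open>k < 1\<close> forces small defects. Of the constant 6, a part 4 comes from
  changing the form and 2 from changing the defect.\<close>

lemma far_agreeing_directions:
  fixes Y z :: "('a::complex_inner, 'b::complex_inner) cblinfun"
  assumes Y: "norm Y \<le> 1" and z: "norm z \<le> 1" and w: "norm w = 1" and u: "norm u = 1"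
    and k: "0 \<le> k" "k \<le> 1"
    and far: "defect Y w * defect z u < k * (cmod (iform Y z w u))\<^sup>2"
  shows "(1 - k) * (defect Y w * defect z u) \<le> 6 * norm (Y \<cdot> u - z \<cdot> u)"
proof -
  let ?\<eta> = "norm (Y \<cdot> u - z \<cdot> u)"
  have Yw: "norm (Y \<cdot> w) \<le> 1" and Yu: "norm (Y \<cdot> u) \<le> 1" and zu: "norm (z \<cdot> u) \<le> 1"
    using norm_cblinfun_apply_le[of Y w] norm_cblinfun_apply_le[of Y u]
      norm_cblinfun_apply_le[of z u] Y z w u by simp_all
  have d: "0 \<le> defect Y w" "defect Y w \<le> 1"
    by (rule defect_nonneg[OF Y]) (simp add: defect_def w)
  have "(cmod (iform Y z w u))\<^sup>2 - (cmod (iform Y Y w u))\<^sup>2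
      = (cmod (iform Y z w u) + cmod (iform Y Y w u)) * (cmod (iform Y z w u) - cmod (iform Y Y w u))"
    by (simp add: power2_eq_square algebra_simps)
  also have "\<dots> \<le> 4 * ?\<eta>"
  proof -
    have "iform Y z w u - iform Y Y w u = cinner (Y \<cdot> w) (Y \<cdot> u - z \<cdot> u)"
      by (simp add: iform_def cinner_diff_right)
    moreover have "norm (Y \<cdot> w) * ?\<eta> \<le> 1 * ?\<eta>" using Yw by (intro mult_right_mono) simp_all
    ultimately have "cmod (iform Y z w u - iform Y Y w u) \<le> ?\<eta>"
      using cmod_cinner_le[of "Y \<cdot> w" "Y \<cdot> u - z \<cdot> u"] by simp
    then have "cmod (iform Y z w u) - cmod (iform Y Y w u) \<le> ?\<eta>"
      using norm_triangle_ineq2 order_trans by blast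
    then have "(cmod (iform Y z w u) + cmod (iform Y Y w u)) * (cmod (iform Y z w u) - cmod (iform Y Y w u))
        \<le> (cmod (iform Y z w u) + cmod (iform Y Y w u)) * ?\<eta>"
      by (intro mult_left_mono) simp_all
    also have "\<dots> \<le> 4 * ?\<eta>"
      using norm_iform_le_2[OF Y z w u] norm_iform_le_2[OF Y Y w u] by (intro mult_right_mono) simp_all
    finally show ?thesis .
  qed
  finally have 1: "(cmod (iform Y z w u))\<^sup>2 \<le> defect Y w * defect Y u + 4 * ?\<eta>"
    using iform_Cauchy_Schwarz[OF Y, of w u] by linarith
  have "defect Y u - defect z u = (norm (z \<cdot> u) + norm (Y \<cdot> u)) * (norm (z \<cdot> u) - norm (Y \<cdot> u))"
    by (simp add: defect_def power2_eq_square algebra_simps)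
  also have "\<dots> \<le> (norm (z \<cdot> u) + norm (Y \<cdot> u)) * ?\<eta>"
    using norm_triangle_ineq2[of "z \<cdot> u" "Y \<cdot> u"]
    by (intro mult_left_mono) (simp_all add: norm_minus_commute)
  also have "\<dots> \<le> 2 * ?\<eta>" using Yu zu by (intro mult_right_mono) simp_all
  finally have "defect Y u \<le> defect z u + 2 * ?\<eta>" by simp
  then have "defect Y w * defect Y u \<le> defect Y w * (defect z u + 2 * ?\<eta>)"
    using d by (intro mult_left_mono)
  also have "\<dots> \<le> defect Y w * defect z u + 2 * ?\<eta>"
    using d mult_right_mono[of "defect Y w" 1 "2 * ?\<eta>"] by (simp add: algebra_simps)
  finally have "(cmod (iform Y z w u))\<^sup>2 \<le> defect Y w * defect z u + 6 * ?\<eta>" using 1 by linarith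
  then have "k * (cmod (iform Y z w u))\<^sup>2 \<le> k * (defect Y w * defect z u + 6 * ?\<eta>)"
    using k by (intro mult_left_mono)
  also have "\<dots> \<le> k * (defect Y w * defect z u) + 6 * ?\<eta>"
    using k mult_right_mono[of k 1 "6 * ?\<eta>"] by (simp add: algebra_simps)
  finally show ?thesis using far by (simp add: algebra_simps)
qed

text \<open>For \<open>0 < k \<le> 1\<close> and \<open>M\<close> in the open ball, these are the
  points of \<open>M\<close> whose Kobayashi ball of radius \<open>artanh (sqrt (1 - k))\<close>
  contains \<open>M\<close>. A larger \<open>k\<close> means a smaller radius; the Chebyshev centers
  belong to the largest \<open>k\<close> with a nonempty result.\<close>

definition center ::
    "real \<Rightarrow> ('a::complex_inner, 'b::complex_inner) cblinfun set \<Rightarrow> ('a, 'b) cblinfun set"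
  where "center k M = {X \<in> M. \<forall>Y\<in>M. near k X Y}"

text \<open>By symmetry of \<open>near\<close> the centers form an intersection of Kobayashi balls,
  so closedness and convexity pass to them.\<close>

lemma center_eq_Int: "center k M = M \<inter> (\<Inter>Y\<in>M. {X. near k Y X})"
  using near_sym by (auto simp: center_def)

lemma closed_center: "closed M \<Longrightarrow> closed (center k M)"
  unfolding center_eq_Int by (intro closed_Int closed_INT ballI closed_near)

lemma convex_center:
  "convex M \<Longrightarrow> 0 \<le> k \<Longrightarrow> (\<And>X. X \<in> M \<Longrightarrow> norm X \<le> 1) \<Longrightarrow> convex (center k M)"
  unfolding center_eq_Int by (intro convex_Int convex_INT convex_near)

lemma center_antimono: "k \<le> k' \<Longrightarrow> center k' M \<subseteq> center k M"
  unfolding center_def using near_mono by blast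

text \<open>The supremum of the admissible coefficients is attained: centers for coefficients
  increasing to it are nested closed convex sets, and a common point is a center for the supremum by
  \<open>near_limit\<close>.\<close>

lemma optimal_center_exists:
  fixes M :: "('a::complex_inner, 'b::chilbert_space) cblinfun set"
  assumes fd: "\<exists>Basis :: 'a set. finite_dimensional_vector_space scaleC Basis"
    and M: "M \<noteq> {}" "closed M" "convex M" and bound: "\<And>X. X \<in> M \<Longrightarrow> norm X \<le> 1"
  shows "\<exists>k. 0 \<le> k \<and> k \<le> 1 \<and> center k M \<noteq> {} \<and>
    (\<forall>k'. k < k' \<longrightarrow> k' \<le> 1 \<longrightarrow> center k' M = {})"
proof -
  define K where "K = {k. 0 \<le> k \<and> k \<le> 1 \<and> center k M \<noteq> {}}"
  have "center 0 M = M" using bound by (auto simp: center_def intro: near_nonpos)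
  then have K0: "0 \<in> K" using M by (simp add: K_def)
  have bdd: "bdd_above K" by (rule bdd_aboveI[of _ 1]) (simp add: K_def)
  define k where "k = Sup K"
  have k0: "0 \<le> k" unfolding k_def using K0 bdd by (rule cSup_upper)
  have k1: "k \<le> 1" unfolding k_def using K0 by (intro cSup_least) (auto simp: K_def)
  \<comment> \<open>Truncation at 0 keeps the coefficient in the range where Kobayashi balls are
    convex.\<close>
  define \<kappa> where "\<kappa> n = max 0 (k - inverse (real (Suc n)))" for n
  have "(\<Inter>n. center (\<kappa> n) M) \<noteq> {}"
  proof (rule nested_closed_convex_inter[OF fd])
    show "closed (center (\<kappa> n) M)" for n by (rule closed_center[OF M(2)])
    show "convex (center (\<kappa> n) M)" for n
      by (rule convex_center[OF M(3) _ bound]) (simp_all add: \<kappa>_def)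
    show "decseq (\<lambda>n. center (\<kappa> n) M)"
      unfolding decseq_def \<kappa>_def
      by (intro allI impI center_antimono max.mono diff_left_mono le_imp_inverse_le) simp_all
    show "norm X \<le> 1" if "X \<in> center (\<kappa> 0) M" for X using that bound by (simp add: center_def)
    show "center (\<kappa> n) M \<noteq> {}" for n
    proof -
      have "k - inverse (real (Suc n)) < Sup K" by (simp add: k_def)
      then obtain k' where k': "k' \<in> K" "k - inverse (real (Suc n)) < k'"
        using less_cSupE K0 by (metis empty_iff)
      then have "\<kappa> n \<le> k'" by (simp add: \<kappa>_def K_def)
      then show ?thesis using center_antimono[of "\<kappa> n" k' M] k' by (auto simp: K_def)
    qed
  qed
  then obtain X where X: "\<And>n. X \<in> center (\<kappa> n) M" by blast
  have "near k X Y" if Y: "Y \<in> M" for Y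
  proof (rule near_limit)
    fix k' assume "k' < k"
    then obtain n where "inverse (real (Suc n)) < k - k'"
      using reals_Archimedean[of "k - k'"] by auto
    then have "k' \<le> \<kappa> n" by (simp add: \<kappa>_def)
    moreover have "near (\<kappa> n) X Y" using X[of n] Y by (simp add: center_def)
    ultimately show "near k' X Y" using near_mono by blast
  qed
  then have "X \<in> center k M" using X[of 0] by (simp add: center_def)
  moreover have "center k' M = {}" if "k < k'" "k' \<le> 1" for k'
  proof (rule ccontr)
    assume "center k' M \<noteq> {}"
    then have "k' \<in> K" using that k0 by (simp add: K_def)
    then have "k' \<le> k" unfolding k_def using bdd by (rule cSup_upper)
    with that show False by simp
  qed
  ultimately show ?thesis using k0 k1 by blast
qed

text \<open>Optimality of \<open>k\<close> provides, for coefficients \<open>\<kappa> n\<close>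
  decreasing to \<open>k\<close>, violations at \<open>z\<close> with unit vectors
  \<open>u n\<close>. A limit \<open>l\<close> of these vectors is the new direction:
  \<open>near_mean_variance\<close> puts it into \<open>agree (center k M)\<close>, and
  \<open>far_agreeing_directions\<close> keeps it out of \<open>agree M\<close>.\<close>

lemma center_agree_increases:
  fixes M :: "('a::complex_inner, 'b::complex_inner) cblinfun set"
  assumes fd: "\<exists>Basis :: 'a set. finite_dimensional_vector_space scaleC Basis"
    and M: "convex M" and bound: "\<And>X. X \<in> M \<Longrightarrow> norm X \<le> r" and r: "r < 1"
    and k: "0 \<le> k" "k < 1" and ne: "center k M \<noteq> {}"
    and opt: "\<And>k'. k < k' \<Longrightarrow> k' \<le> 1 \<Longrightarrow> center k' M = {}"
  shows "\<not> agree (center k M) \<subseteq> agree M"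
proof -
  let ?C = "center k M"
  have bound1: "norm X \<le> 1" if "X \<in> M" for X using bound[OF that] r by simp
  obtain F where F: "finite F" "F \<noteq> {}" "F \<subseteq> ?C" and agreeF: "agree F = agree ?C"
    using agree_finite_subset[OF fd ne] by blast
  define N where "N = real (card F)"
  have N: "0 < N" using F by (simp add: N_def card_gt_0_iff)
  define z where "z = inverse (real (card F)) *\<^sub>R (\<Sum>X\<in>F. X)"
  have "z \<in> ?C"
  proof -
    have "(\<Sum>X\<in>F. inverse (real (card F)) *\<^sub>R X) \<in> ?C"
      using F N by (intro convex_sum convex_center M k bound1) (auto simp: N_def)
    then show ?thesis by (simp add: z_def scaleR_sum_right)
  qed
  then have zM: "z \<in> M" by (simp add: center_def)
  \<comment> \<open>The double successor keeps \<open>\<kappa> n\<close> at most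
    \<open>(1 + k) / 2\<close>, so that \<open>1 - \<kappa> n\<close> stays bounded away from
    0.\<close>
  define \<kappa> where "\<kappa> n = k + (1 - k) * inverse (real (Suc (Suc n)))" for n
  have inv_half: "inverse (real (Suc (Suc n))) \<le> 1 / 2" for n by (simp add: field_simps)
  have \<kappa>: "k < \<kappa> n" "\<kappa> n \<le> 1" "(1 - k) / 2 \<le> 1 - \<kappa> n" for n
  proof -
    show "k < \<kappa> n" using k by (simp add: \<kappa>_def)
    have "(1 - k) * inverse (real (Suc (Suc n))) \<le> (1 - k) * (1 / 2)"
      using k by (intro mult_left_mono inv_half) simp
    then show "(1 - k) / 2 \<le> 1 - \<kappa> n" by (simp add: \<kappa>_def)
    then show "\<kappa> n \<le> 1" using k by simp
  qed
  have "\<exists>Y w u. Y \<in> M \<and> norm w = 1 \<and> norm u = 1 \<and>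
      defect Y w * defect z u < \<kappa> n * (cmod (iform Y z w u))\<^sup>2" for n
  proof -
    have "z \<notin> center (\<kappa> n) M" using opt[OF \<kappa>(1,2)] by blast
    then obtain Y where Y: "Y \<in> M" "\<not> near (\<kappa> n) z Y" using zM by (auto simp: center_def)
    then have "\<not> near (\<kappa> n) Y z" using near_sym by blast
    from not_near_unit_vectors[OF this] Y show ?thesis by blast
  qed
  then obtain Y w u where Y: "\<And>n. Y n \<in> M" and w: "\<And>n. norm (w n) = 1"
    and u: "\<And>n. norm (u n) = 1"
    and far: "\<And>n. defect (Y n) (w n) * defect z (u n)
      < \<kappa> n * (cmod (iform (Y n) z (w n) (u n)))\<^sup>2"
    by metis
  have r0: "0 \<le> r" using bound[OF zM] norm_ge_zero order_trans by blast
  \<comment> \<open>A uniform positive lower bound for the defects of elements of \<open>M\<close>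
    on unit vectors, available because \<open>r < 1\<close>.\<close>
  define c where "c = 1 - r\<^sup>2"
  have c: "0 < c" using r r0 by (simp add: c_def abs_square_less_1)
  have defect_c: "c \<le> defect X v" if "X \<in> M" "norm v = 1" for X v
  proof -
    have "(norm X)\<^sup>2 \<le> r\<^sup>2" using bound[OF that(1)] by (intro power_mono) simp_all
    then show ?thesis using defect_ge[of X v] that by (simp add: c_def)
  qed
  define V where "V v = (\<Sum>X\<in>F. (norm (X \<cdot> v - z \<cdot> v))\<^sup>2)" for v
  have V0: "0 \<le> V v" for v by (simp add: V_def sum_nonneg)
  have V_le: "V (u n) \<le> 4 * N * (\<kappa> n - k) / c" for n
  proof -
    have "defect (Y n) (w n) * V (u n) \<le> 4 * N * (\<kappa> n - k)"
      unfolding V_def N_def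
    proof (rule near_mean_variance[OF F(1) _ z_def k(1) _ _ _ w u far])
      show "near k (Y n) X" if "X \<in> F" for X
        using subsetD[OF F(3) that] Y[of n] by (auto simp: center_def intro: near_sym)
    qed (use \<kappa>(1)[of n] bound1 Y zM in simp_all)
    moreover have "c * V (u n) \<le> defect (Y n) (w n) * V (u n)"
      using defect_c[OF Y w] V0 by (intro mult_right_mono)
    ultimately show ?thesis using c by (simp add: pos_le_divide_eq mult.commute)
  qed
  obtain l s where s: "strict_mono (s :: nat \<Rightarrow> nat)" and lim: "(\<lambda>n. u (s n)) \<longlonglongrightarrow> l"
    and l: "norm l = 1"
    using unit_vectors_subsequence[where u = u, OF fd u] by blast
  have "\<kappa> \<longlonglongrightarrow> k + (1 - k) * 0"
    unfolding \<kappa>_def[abs_def] by (intro tendsto_intros LIMSEQ_Suc[OF LIMSEQ_inverse_real_of_nat])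
  then have "(\<lambda>n. 4 * N * (\<kappa> n - k) / c) \<longlonglongrightarrow> 4 * N * (k - k) / c"
    by (intro tendsto_intros) (use c in simp_all)
  then have upper: "(\<lambda>n. 4 * N * (\<kappa> n - k) / c) \<longlonglongrightarrow> 0" by simp
  have "(\<lambda>n. V (u n)) \<longlonglongrightarrow> 0"
    by (rule tendsto_sandwich[OF _ _ tendsto_const upper]) (simp_all add: V0 V_le)
  then have "(\<lambda>n. V (u (s n))) \<longlonglongrightarrow> 0"
    using LIMSEQ_subseq_LIMSEQ[OF _ s] by (simp add: o_def)
  moreover have "(\<lambda>n. V (u (s n))) \<longlonglongrightarrow> V l"
    unfolding V_def by (intro tendsto_intros tendsto_cblinfun_apply lim)
  ultimately have "V l = 0" using LIMSEQ_unique by blast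
  then have "X \<cdot> l = z \<cdot> l" if "X \<in> F" for X
    using that F(1) by (simp add: V_def sum_nonneg_eq_0_iff)
  then have "l \<in> agree F" by (simp add: agree_def)
  moreover have "l \<notin> agree M"
  proof
    assume lM: "l \<in> agree M"
    \<comment> \<open>If \<open>Y n\<close> and \<open>z\<close> agree at \<open>l\<close>, then
      \<open>Y n (u n) - z (u n)\<close> depends only on \<open>u n - l\<close>. The constant 12 is
      6 from \<open>far_agreeing_directions\<close> times the bound 2 for
      \<open>norm (Y n - z)\<close>.\<close>
    have ineq: "(1 - k) / 2 * (c * c) \<le> 12 * norm (u n - l)" for n
    proof -
      have "(1 - k) / 2 * (c * c) \<le> (1 - \<kappa> n) * (defect (Y n) (w n) * defect z (u n))"
        using \<kappa>(2,3)[of n] k c defect_c[OF Y w, of n n] defect_c[OF zM u, of n]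
        by (intro mult_mono mult_nonneg_nonneg) simp_all
      also have "\<dots> \<le> 6 * norm (Y n \<cdot> u n - z \<cdot> u n)"
        using bound1[OF Y] bound1[OF zM] k \<kappa>[of n]
        by (intro far_agreeing_directions[OF _ _ w u _ _ far]) simp_all
      also have "Y n \<cdot> u n - z \<cdot> u n = (Y n - z) \<cdot> (u n - l)"
      proof -
        have "Y n \<cdot> l = z \<cdot> l" using lM Y[of n] zM unfolding agree_def by blast
        then show ?thesis by (simp add: cblinfun_apply_right)
      qed
      also have "norm \<dots> \<le> 2 * norm (u n - l)"
      proof -
        have "norm (Y n - z) \<le> 2"
          using norm_triangle_ineq4[of "Y n" z] bound1[OF Y, of n] bound1[OF zM] by linarith
        then show ?thesis
          using norm_cblinfun_apply_le[of "Y n - z" "u n - l"]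
          by (meson mult_right_mono norm_ge_zero order_trans)
      qed
      finally show ?thesis by simp
    qed
    have "(\<lambda>n. 12 * norm (u (s n) - l)) \<longlonglongrightarrow> 12 * norm (l - l)"
      by (intro tendsto_intros lim)
    then have "(1 - k) / 2 * (c * c) \<le> 12 * norm (l - l)"
      by (rule LIMSEQ_le_const) (use ineq in blast)
    moreover have "0 < (1 - k) / 2 * (c * c)" using k c by simp
    ultimately show False by simp
  qed
  ultimately show ?thesis using agreeF by blast
qed

text \<open>It remains to exclude the optimal value \<open>k = 1\<close>: such a center would equal
  every point of \<open>M\<close>, contrary to \<open>X \<noteq> Y\<close>.\<close>

lemma proper_center_exists:
  fixes M :: "('a::complex_inner, 'b::chilbert_space) cblinfun set"
  assumes fd: "\<exists>Basis :: 'a set. finite_dimensional_vector_space scaleC Basis"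
    and M: "M \<noteq> {}" "closed M" "convex M" and bound: "\<And>X. X \<in> M \<Longrightarrow> norm X \<le> r" and r: "r < 1"
    and X: "X \<in> M" and Y: "Y \<in> M" "X \<noteq> Y"
  shows "\<exists>k. 0 \<le> k \<and> k \<le> 1 \<and> center k M \<noteq> {} \<and> \<not> agree (center k M) \<subseteq> agree M"
proof -
  have bound1: "norm X \<le> 1" if "X \<in> M" for X using bound[OF that] r by simp
  obtain k where k: "0 \<le> k" "k \<le> 1" "center k M \<noteq> {}"
    and opt: "\<And>k'. k < k' \<Longrightarrow> k' \<le> 1 \<Longrightarrow> center k' M = {}"
    using optimal_center_exists[OF fd M bound1] by blast
  have "k \<noteq> 1"
  proof
    assume "k = 1"
    with k obtain Z where Z: "Z \<in> center 1 M" by blast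
    have "Z = W" if "W \<in> M" for W
      using near_one_imp_eq[of Z W] Z that bound1 by (simp add: center_def)
    with X Y show False by metis
  qed
  then show ?thesis
    using k center_agree_increases[OF fd M(3) bound r k(1) _ k(3) opt] by force
qed

section \<open>The fixed point\<close>

theorem lemma4p3:
  fixes \<BB> :: "('h2::chilbert_space, 'h1::chilbert_space) cblinfun set"
    and \<Gamma> :: "(('h2, 'h1) cblinfun \<Rightarrow> ('h2, 'h1) cblinfun) set"
    and r :: real
  defines "\<BB> \<equiv> {X. norm X < 1}"
  assumes "\<exists>Basis :: 'h2 set. finite_dimensional_vector_space scaleC Basis"
    and "subgroup \<Gamma> (BijGroup \<BB>)"
    and "\<Gamma> \<subseteq> Biholomorphic \<BB>"
    and "r < 1"
    and "\<exists>X\<in>\<BB>. {\<phi> X | \<phi>. \<phi> \<in> \<Gamma>} \<subseteq> {Y. norm Y \<le> r}"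
  shows "\<exists>K. norm K \<le> r \<and> (\<forall>\<phi>\<in>\<Gamma>. \<phi> K = K)"
proof -
  note fd = assms(2)
  obtain X0 where X0: "X0 \<in> \<BB>" and orbit_le: "\<And>\<phi>. \<phi> \<in> \<Gamma> \<Longrightarrow> norm (\<phi> X0) \<le> r"
    using assms(6) by blast
  have \<BB>: "X \<in> \<BB> \<longleftrightarrow> norm X < 1" for X by (simp add: \<BB>_def)
  have bij: "\<phi> \<in> Bij \<BB>" and hol: "frechet_holomorphic_on \<phi> \<BB>" if "\<phi> \<in> \<Gamma>" for \<phi>
    using assms(4) that by (auto simp: Biholomorphic_def)
  have into: "\<phi> X \<in> \<BB>" if "\<phi> \<in> \<Gamma>" "X \<in> \<BB>" for \<phi> X
    using bij[OF that(1)] that(2) by (auto simp: Bij_def bij_betw_def)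
  have near_image: "near k (\<phi> Z) (\<phi> X)" if "\<phi> \<in> \<Gamma>" "near k Z X" "Z \<in> \<BB>" "X \<in> \<BB>" "k \<le> 1" for \<phi> k Z X
    using near_holomorphic_image[OF fd fd, of \<phi> Z X k] hol[OF that(1)] into[OF that(1)] that(2-)
    by (simp add: \<BB> \<BB>_def)
  have inverse: "\<exists>\<psi>\<in>\<Gamma>. \<forall>X\<in>\<BB>. \<phi> (\<psi> X) = X" if "\<phi> \<in> \<Gamma>" for \<phi>
  proof (intro bexI ballI)
    show "inv\<^bsub>BijGroup \<BB>\<^esub> \<phi> \<in> \<Gamma>" using subgroup.m_inv_closed[OF assms(3) that] .
    fix X assume X: "X \<in> \<BB>"
    have "\<phi> ` \<BB> = \<BB>" using bij[OF that] by (simp add: Bij_def bij_betw_def)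
    then show "\<phi> ((inv\<^bsub>BijGroup \<BB>\<^esub> \<phi>) X) = X"
      using X by (simp add: inv_BijGroup[OF bij[OF that]] f_inv_into_f)
  qed
  define Orb where "Orb = {\<phi> X0 | \<phi>. \<phi> \<in> \<Gamma>}"
  have Orb_le: "norm X \<le> r" if "X \<in> Orb" for X using that orbit_le by (auto simp: Orb_def)
  have one: "(\<lambda>X\<in>\<BB>. X) \<in> \<Gamma>"
    using subgroup.one_closed[OF assms(3)] by (simp add: BijGroup_def)
  then have "(\<lambda>X\<in>\<BB>. X) X0 \<in> Orb" unfolding Orb_def by blast
  then have X0_Orb: "X0 \<in> Orb" using X0 by simp
  have r0: "0 \<le> r" using Orb_le[OF X0_Orb] norm_ge_zero order_trans by blast
  have r\<BB>: "X \<in> \<BB>" if "norm X \<le> r" for X using that assms(5) by (simp add: \<BB>)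
  have Orb_inv: "\<phi> X \<in> Orb" if \<phi>: "\<phi> \<in> \<Gamma>" and X: "X \<in> Orb" for \<phi> X
  proof -
    obtain \<psi> where \<psi>: "\<psi> \<in> \<Gamma>" "X = \<psi> X0" using X by (auto simp: Orb_def)
    have "\<phi> \<otimes>\<^bsub>BijGroup \<BB>\<^esub> \<psi> \<in> \<Gamma>" using subgroup.m_closed[OF assms(3) \<phi> \<psi>(1)] .
    then have "(\<phi> \<otimes>\<^bsub>BijGroup \<BB>\<^esub> \<psi>) X0 \<in> Orb" unfolding Orb_def by blast
    moreover have "(\<phi> \<otimes>\<^bsub>BijGroup \<BB>\<^esub> \<psi>) X0 = \<phi> X"
      using bij \<phi> \<psi> X0 by (simp add: BijGroup_def compose_def)
    ultimately show ?thesis by simp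
  qed
  \<comment> \<open>The invariant sets among which one with \<open>agree\<close> of largest
    dimension is chosen.\<close>
  define P where "P M \<longleftrightarrow> M \<noteq> {} \<and> closed M \<and> convex M \<and> (\<forall>X\<in>M. norm X \<le> r) \<and>
    (\<forall>\<phi>\<in>\<Gamma>. \<forall>X\<in>M. \<phi> X \<in> M)" for M
  have P_center: "P (center k M)" if M: "P M" and k: "0 \<le> k" "k \<le> 1" "center k M \<noteq> {}" for k M
  proof -
    have M\<BB>: "X \<in> \<BB>" and M_inv: "\<phi> \<in> \<Gamma> \<Longrightarrow> \<phi> X \<in> M" if "X \<in> M" for X \<phi>
      using that M r\<BB> unfolding P_def by blast+
    have sub: "center k M \<subseteq> M" by (auto simp: center_def)
    have "\<phi> X \<in> center k M" if \<phi>: "\<phi> \<in> \<Gamma>" and X: "X \<in> center k M" for \<phi> X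
    proof -
      have XM: "X \<in> M" using X sub by blast
      have "near k (\<phi> X) Y" if Y: "Y \<in> M" for Y
      proof -
        \<comment> \<open>Every \<open>Y\<close> in \<open>M\<close> is the image under
          \<open>\<phi>\<close> of a point of \<open>M\<close>, so nearness of \<open>X\<close> to
          all of \<open>M\<close> is carried over to \<open>\<phi> X\<close>.\<close>
        obtain \<psi> where \<psi>: "\<psi> \<in> \<Gamma>" "\<phi> (\<psi> Y) = Y" using inverse[OF \<phi>] M\<BB>[OF Y] by blast
        have \<psi>Y: "\<psi> Y \<in> M" using M_inv[OF Y \<psi>(1)] .
        then have "near k X (\<psi> Y)" using X by (simp add: center_def)
        from near_image[OF \<phi> this M\<BB>[OF XM] M\<BB>[OF \<psi>Y] k(2)] show ?thesis by (simp only: \<psi>(2))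
      qed
      then show ?thesis using M_inv[OF XM \<phi>] by (simp add: center_def)
    qed
    moreover have "norm X \<le> 1" if "X \<in> M" for X using M\<BB>[OF that] by (simp add: \<BB>)
    then have "convex (center k M)"
      using M k unfolding P_def by (intro convex_center) blast+
    ultimately show ?thesis
      using M k(3) sub closed_center[of M k] unfolding P_def by blast
  qed
  \<comment> \<open>The norm ball intersected with all Kobayashi balls about points of
    \<open>\<BB>\<close> that contain the orbit.\<close>
  define M0 where "M0 = {X. norm X \<le> r \<and>
    (\<forall>Y\<in>\<BB>. \<forall>k. 0 \<le> k \<and> k \<le> 1 \<and> (\<forall>Z\<in>Orb. near k Y Z) \<longrightarrow> near k Y X)}"
  have "P M0"
    unfolding P_def
  proof (intro conjI ballI)
    show "M0 \<noteq> {}" using X0_Orb Orb_le by (auto simp: M0_def)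
    have eq: "M0 = cball 0 r \<inter> (\<Inter>Y\<in>\<BB>. \<Inter>k\<in>{k. 0 \<le> k \<and> k \<le> 1 \<and> (\<forall>Z\<in>Orb. near k Y Z)}. {X. near k Y X})"
      by (auto simp: M0_def)
    show "closed M0"
      unfolding eq by (intro closed_Int closed_cball closed_INT ballI closed_near)
    show "convex M0"
      unfolding eq by (intro convex_Int convex_cball convex_INT convex_near) (auto simp: \<BB>)
    show "norm X \<le> r" if "X \<in> M0" for X using that by (simp add: M0_def)
    fix \<phi> X assume \<phi>: "\<phi> \<in> \<Gamma>" and X: "X \<in> M0"
    have X\<BB>: "X \<in> \<BB>" using X r\<BB> by (simp add: M0_def)
    have near: "near k Y (\<phi> X)"
      if Y: "Y \<in> \<BB>" and k: "0 \<le> k" "k \<le> 1" and O: "\<forall>Z\<in>Orb. near k Y Z" for Y k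
    proof -
      obtain \<psi> where \<psi>: "\<psi> \<in> \<Gamma>" "\<forall>X\<in>\<BB>. \<phi> (\<psi> X) = X" using inverse[OF \<phi>] by blast
      \<comment> \<open>Writing \<open>Z = \<psi> (\<psi>' Z)\<close> with \<open>\<psi>' Z\<close>
        in the orbit shows that \<open>\<psi>\<close> carries a ball containing the orbit to another
        one.\<close>
      obtain \<psi>' where \<psi>': "\<psi>' \<in> \<Gamma>" "\<forall>X\<in>\<BB>. \<psi> (\<psi>' X) = X" using inverse[OF \<psi>(1)] by blast
      have \<psi>Y: "\<psi> Y \<in> \<BB>" using into[OF \<psi>(1) Y] .
      have "near k (\<psi> Y) Z" if Z: "Z \<in> Orb" for Z
      proof -
        have Z': "\<psi>' Z \<in> Orb" using Orb_inv[OF \<psi>'(1) Z] .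
        then have "near k Y (\<psi>' Z)" using O by blast
        from near_image[OF \<psi>(1) this Y r\<BB>[OF Orb_le[OF Z']] k(2)]
        show ?thesis by (simp only: \<psi>'(2)[rule_format, OF r\<BB>[OF Orb_le[OF Z]]])
      qed
      then have "near k (\<psi> Y) X" using X k \<psi>Y by (simp add: M0_def)
      from near_image[OF \<phi> this \<psi>Y X\<BB> k(2)]
      show ?thesis by (simp only: \<psi>(2)[rule_format, OF Y])
    qed
    \<comment> \<open>Although \<open>\<phi>\<close> need not preserve norms, the norm bound
      survives: the ball of radius \<open>r\<close> is a Kobayashi ball about 0 that contains the
      orbit.\<close>
    have "near (1 - r\<^sup>2) 0 (\<phi> X)"
    proof (rule near)
      show "\<forall>Z\<in>Orb. near (1 - r\<^sup>2) 0 Z" 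
        using Orb_le by (simp add: near_zero_iff[OF r0 less_imp_le[OF assms(5)]])
    qed (use r0 assms(5) in \<open>simp_all add: \<BB> power_le_one\<close>)
    then have "norm (\<phi> X) \<le> r" by (simp add: near_zero_iff[OF r0 less_imp_le[OF assms(5)]])
    with near show "\<phi> X \<in> M0" by (simp add: M0_def)
  qed
  from fd obtain B :: "'h2 set" where B: "finite_dimensional_vector_space scaleC B" by blast
  then interpret fd: finite_dimensional_vector_space scaleC B .
  \<comment> \<open>The dimension is bounded by that of the whole space, so a maximal choice
    exists.\<close>
  have "\<forall>M. P M \<longrightarrow> fd.dim (agree M) < Suc fd.dimension"
    using fd.dim_subset_UNIV le_imp_less_Suc by blast
  from ex_has_greatest_nat[of P, OF \<open>P M0\<close> this]
  obtain M where M: "P M" and max: "\<And>M'. P M' \<Longrightarrow> fd.dim (agree M') \<le> fd.dim (agree M)" by blast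
  have single: "X = Y" if XY: "X \<in> M" "Y \<in> M" for X Y
  proof (rule ccontr)
    assume "X \<noteq> Y"
    then obtain k where k: "0 \<le> k" "k \<le> 1" "center k M \<noteq> {}"
      and not: "\<not> agree (center k M) \<subseteq> agree M"
      using proper_center_exists[OF fd _ _ _ _ assms(5) XY] M unfolding P_def by blast
    \<comment> \<open>The centers again satisfy \<open>P\<close>, so by maximality the larger
      subspace has no larger dimension.\<close>
    have "agree M = agree (center k M)"
    proof (intro fd.subspace_dim_equal subspace_agree[OF B] max P_center[OF M k])
      show "agree M \<subseteq> agree (center k M)" by (rule agree_mono) (auto simp: center_def)
    qed
    with not show False by simp
  qed
  obtain K where K: "K \<in> M" using M by (auto simp: P_def)
  have "\<phi> K = K" if "\<phi> \<in> \<Gamma>" for \<phi>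
    using M K that by (intro single) (simp_all add: P_def)
  moreover have "norm K \<le> r" using M K by (simp add: P_def)
  ultimately show ?thesis by blast
qed

end
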